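(* Let $G,c>0$ be constants, let $\Omega=\Phi\,\mathrm{dvol}_{g_{\mathbb{E}}}$ be a matter distribution on $\mathbb{R}^3$ with $\Phi\ge 0$ smooth and compactly supported and with $m:=\int_{\mathbb{R}^3}\Omega>0$, let $r_n>0$ be a sequence with $r_n\to 0$, and put $d_n=\left(\frac{G}{2c^2}\cdot\frac{m}{r_n}\right)^{-1}$. For $\alpha\in[0,1]$ let $\omega_{\alpha,n}=d_n^{-\alpha}\,(\mathcal{H}_{d_n})_*\Omega$, where $\mathcal{H}_{d_n}(x)=d_n x$, and let $\theta_{\alpha,n}$ be the unique positive smooth solution on $\mathbb{R}^3$ of $$\theta_{\alpha,n}^\alpha\,\Delta_{g_{\mathbb{E}}}\theta_{\alpha,n}\,\mathrm{dvol}_{g_{\mathbb{E}}}=-4\pi\tfrac{G}{2c^2}\,\omega_{\alpha,n},\qquad \lim_{x\to\infty}\theta_{\alpha,n}(x)=1.$$ Let $\Theta_\alpha$ be the unique positive smooth solution on $\mathbb{R}^3$ of $$\Theta_\alpha^\alpha\,\Delta_{g_{\mathbb{E}}}\Theta_\alpha\,\mathrm{dvol}_{g_{\mathbb{E}}}=-4\pi\tfrac{G}{2c^2}\,\Omega,\qquad \lim_{x\to\infty}\Theta_\alpha(x)=0,$$ and set $$m_{\mathrm{eff}}(\alpha):=\int_{\mathbb{R}^3}\frac{\Omega(y)}{\Theta_\alpha(y)^\alpha},\qquad \theta_{\mathrm{Schw},\alpha}(z):=1+\frac{G}{2c^2}\cdot\frac{m_{\mathrm{eff}}(\alpha)}{|z|}\quad(z\in\mathbb{R}^3\setminus\{0\}).$$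 Then, for each fixed $\alpha\in[0,1]$, as $n\to\infty$ the functions $\theta_{\alpha,n}$ converge to $\theta_{\mathrm{Schw},\alpha}$ uniformly with all derivatives on all compact subsets of $\mathbb{R}^3\setminus\{0\}$. Furthermore, the function $\alpha\mapsto m_{\mathrm{eff}}(\alpha)$ is continuous on $[0,1]$.
   Context: $g_{\mathbb{E}}$ is the Euclidean metric on $\mathbb{R}^3$, $\Delta_{g_{\mathbb{E}}}=\partial_1^2+\partial_2^2+\partial_3^2$ its Laplacian, and $\mathrm{dvol}_{g_{\mathbb{E}}}$ its volume form (Lebesgue measure). A matter distribution is written $\omega=\phi\,\mathrm{dvol}_{g_{\mathbb{E}}}$ with density $\phi\ge 0$ smooth and compactly supported; for such $\omega$ and a function $f$, $\int f(y)\,\omega(y)$ means $\int_{\mathbb{R}^3} f(y)\phi(y)\,dy$, and the equation $\theta^\alpha\Delta_{g_{\mathbb{E}}}\theta\,\mathrm{dvol}_{g_{\mathbb{E}}}=-4\pi\frac{G}{2c^2}\omega$ means $\theta^\alpha\Delta_{g_{\mathbb{E}}}\theta=-4\pi\frac{G}{2c^2}\phi$ pointwise. For $d>0$, $(\mathcal{H}_d)_*\Omega$ is the push-forward of $\Omega$ under the dilation $\mathcal{H}_d:x\mapsto d\,x$, i.e. the distribution with density $x\mapsto d^{-3}\Phi(x/d)$; thus $\omega_{\alpha,n}$ has density $x\mapsto d_n^{-\alpha-3}\Phi(x/d_n)$ (a "self-similar sequence of $\Omega$-type and interactivity $\alpha$"). Convergence "uniformly with all derivatives on a compact set $K$" means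 that for every multi-index $\gamma$, $\partial^\gamma\theta_{\alpha,n}\to\partial^\gamma\theta_{\mathrm{Schw},\alpha}$ uniformly on $K$. *)

theory Defs
  imports "HOL-Analysis.Analysis"
begin

text \<open>A matter distribution \<open>\<omega> = \<phi> dvol\<close> is represented by its density \<open>\<phi> :: real^3 \<Rightarrow> real\<close>,
  the volume measure of the Euclidean metric being \<^const>\<open>lborel\<close>.\<close>

definition partial_deriv :: "3 \<Rightarrow> (real^3 \<Rightarrow> real) \<Rightarrow> real^3 \<Rightarrow> real" where
  "partial_deriv i f x = deriv (\<lambda>t. f (x + t *\<^sub>R axis i 1)) 0"

definition multi_deriv :: "nat^3 \<Rightarrow> (real^3 \<Rightarrow> real) \<Rightarrow> real^3 \<Rightarrow> real" where
  "multi_deriv \<gamma> f =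
     (partial_deriv 1 ^^ (\<gamma> $ 1)) ((partial_deriv 2 ^^ (\<gamma> $ 2)) ((partial_deriv 3 ^^ (\<gamma> $ 3)) f))"

definition laplacian :: "(real^3 \<Rightarrow> real) \<Rightarrow> real^3 \<Rightarrow> real" where
  "laplacian f x = (\<Sum>i\<in>UNIV. partial_deriv i (partial_deriv i f) x)"

text \<open>On an open set, being (Frechet) differentiable with partial derivatives of class \<open>C\<^sup>k\<close> is the
  same as being of class \<open>C\<^bsup>k+1\<^esup>\<close>; differentiability keeps \<^const>\<open>deriv\<close> from
  returning arbitrary values.\<close>

primrec C_times :: "nat \<Rightarrow> (real^3 \<Rightarrow> real) \<Rightarrow> bool" where
  "C_times 0 f \<longleftrightarrow> continuous_on UNIV f"
| "C_times (Suc k) f \<longleftrightarrow> f differentiable_on UNIV \<and> (\<forall>i. C_times k (partial_deriv i f))"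

definition smooth :: "(real^3 \<Rightarrow> real) \<Rightarrow> bool" where
  "smooth f \<longleftrightarrow> (\<forall>k. C_times k f)"

definition matter_density :: "(real^3 \<Rightarrow> real) \<Rightarrow> bool" where
  "matter_density \<phi> \<longleftrightarrow> (\<forall>x. 0 \<le> \<phi> x) \<and> smooth \<phi> \<and> compact (closure {x. \<phi> x \<noteq> 0})"

text \<open>Density of the push-forward of \<open>\<phi> dvol\<close> under the dilation \<open>x \<mapsto> d x\<close>, for \<open>d > 0\<close>.\<close>

definition pushforward_dilation :: "real \<Rightarrow> (real^3 \<Rightarrow> real) \<Rightarrow> real^3 \<Rightarrow> real" where
  "pushforward_dilation d \<phi> x = d powr (-3) * \<phi> (x /\<^sub>R d)"

lemma pushforward_dilation_distr:
  assumes d: "0 < d" and [measurable]: "\<phi> \<in> borel_measurable borel" and nn: "\<And>x. 0 \<le> \<phi> x"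
  shows "distr (density lborel \<phi>) borel (\<lambda>x. d *\<^sub>R x) = density lborel (pushforward_dilation d \<phi>)"
proof -
  have L: "(lborel :: (real^3) measure) =
      density (distr lborel borel (\<lambda>x. 0 + d *\<^sub>R x)) (\<lambda>_. \<bar>d\<bar> ^ DIM(real^3))"
    using d by (intro lborel_affine) auto
  have D: "d powr (-3) * d ^ 3 = 1"
    using d by (simp add: powr_minus powr_numeral)
  have "density lborel (pushforward_dilation d \<phi>) =
      density (density (distr lborel borel (\<lambda>x. 0 + d *\<^sub>R x)) (\<lambda>_. \<bar>d\<bar> ^ DIM(real^3)))
        (pushforward_dilation d \<phi>)"
    by (subst L) simp
  also have "\<dots> = density (distr lborel borel (\<lambda>x. d *\<^sub>R x))
      (\<lambda>x. ennreal (\<bar>d\<bar> ^ DIM(real^3)) * ennreal (pushforward_dilation d \<phi> x))"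
    by (subst density_density_eq) (simp_all add: pushforward_dilation_def)
  also have "\<dots> = density (distr lborel borel (\<lambda>x. d *\<^sub>R x)) (\<lambda>x. ennreal (\<phi> (x /\<^sub>R d)))"
  proof -
    have "ennreal (\<bar>d\<bar> ^ DIM(real^3)) * ennreal (pushforward_dilation d \<phi> x) = ennreal (\<phi> (x /\<^sub>R d))" for x
    proof -
      have "\<bar>d\<bar> ^ DIM(real^3) * pushforward_dilation d \<phi> x = (d powr (-3) * d ^ 3) * \<phi> (x /\<^sub>R d)"
        using d by (simp add: pushforward_dilation_def)
      then show ?thesis
        using d nn D by (subst ennreal_mult'[symmetric]) auto
    qed
    then show ?thesis by simp
  qed
  also have "\<dots> = distr (density lborel (\<lambda>x. ennreal (\<phi> ((d *\<^sub>R x) /\<^sub>R d)))) borel (\<lambda>x. d *\<^sub>R x)"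
    by (subst density_distr) simp_all
  also have "\<dots> = distr (density lborel \<phi>) borel (\<lambda>x. d *\<^sub>R x)"
    using d by simp
  finally show ?thesis ..
qed

text \<open>As \<open>u > 0\<close>, the real power \<^const>\<open>powr\<close> is the genuine \<open>u\<^sup>\<alpha>\<close>, with \<open>u\<^sup>0 = 1\<close>. The equation of
  volume forms is stated for their densities.\<close>

definition is_solution ::
    "real \<Rightarrow> real \<Rightarrow> real \<Rightarrow> (real^3 \<Rightarrow> real) \<Rightarrow> real \<Rightarrow> (real^3 \<Rightarrow> real) \<Rightarrow> bool" where
  "is_solution G c \<alpha> \<phi> L u \<longleftrightarrow>
     (\<forall>x. 0 < u x) \<and> smooth u \<and>
     (\<forall>x. u x powr \<alpha> * laplacian u x = - 4 * pi * (G / (2 * c\<^sup>2)) * \<phi> x) \<and>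
     (u \<longlongrightarrow> L) at_infinity"

definition effective_mass :: "(real^3 \<Rightarrow> real) \<Rightarrow> real \<Rightarrow> (real^3 \<Rightarrow> real) \<Rightarrow> real" where
  "effective_mass \<phi> \<alpha> \<Theta> = (LINT y|lborel. \<phi> y / \<Theta> y powr \<alpha>)"

definition theta_Schw :: "real \<Rightarrow> real \<Rightarrow> real \<Rightarrow> real^3 \<Rightarrow> real" where
  "theta_Schw G c M z = 1 + G / (2 * c\<^sup>2) * (M / norm z)"

end

theory Submission
  imports Defs
begin

text \<open>With \<open>k = G / (2 c\<^sup>2)\<close>, the dilated function \<open>U\<^sub>n(y) = d\<^sub>n \<theta>\<^sub>n(d\<^sub>n y)\<close> solves the same equation as \<open>\<Theta>\<close>, but
  with limit \<open>d\<^sub>n\<close> at infinity. Since the right-hand side \<open>- 4 \<pi> k \<Phi> / u\<^sup>\<alpha>\<close> is nondecreasing in \<open>u\<close>, the maximum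
  principle gives \<open>\<Theta> \<le> U\<^sub>n \<le> \<Theta> + d\<^sub>n\<close>. Away from the support of its source, a solution is its limit at
  infinity plus a Newtonian potential; after rescaling, for \<open>|x|\<close> large compared with \<open>d\<^sub>n\<close>,
  \<open>\<theta>\<^sub>n(x) = 1 + k \<integral> \<Phi>(y) U\<^sub>n(y)\<^bsup>-\<alpha>\<^esup> / |x - d\<^sub>n y| dy\<close>. All derivatives can be taken under the integral sign, and the
  Schwarzschild factor is the same expression with \<open>d\<^sub>n = 0\<close> and \<open>\<Theta>\<close> in place of \<open>U\<^sub>n\<close>.

  For the continuity of the effective mass, \<open>exp (C |\<alpha> - \<beta>|) \<Theta>\<^sub>\<beta>\<close> is a supersolution of the equation for
  \<open>\<Theta>\<^sub>\<alpha>\<close> and vice versa, so \<open>|ln \<Theta>\<^sub>\<alpha> - ln \<Theta>\<^sub>\<beta>| \<le> C |\<alpha> - \<beta>|\<close>.\<close>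

section \<open>Partial derivatives and the maximum principle\<close>

lemma frechet_imp_partial:
  fixes f :: "real^'n \<Rightarrow> real"
  assumes "(f has_derivative f') (at x)"
  shows "((\<lambda>t. f (x + t *\<^sub>R axis i 1)) has_real_derivative f' (axis i 1)) (at 0)"
proof -
  have "((\<lambda>t. x + t *\<^sub>R axis i (1::real)) has_derivative (\<lambda>t. t *\<^sub>R axis i 1)) (at 0)"
    by (auto intro!: derivative_eq_intros)
  moreover have "(f has_derivative f') (at (x + 0 *\<^sub>R axis i (1::real)))"
    using assms by simp
  ultimately have "((\<lambda>t. f (x + t *\<^sub>R axis i 1)) has_derivative (\<lambda>t. f' (t *\<^sub>R axis i 1))) (at 0)"
    by (rule has_derivative_compose)
  moreover have "f' (t *\<^sub>R axis i 1) = f' (axis i 1) * t" for t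
    using linear_scale[OF has_derivative_linear[OF assms]] by simp
  ultimately show ?thesis
    by (simp add: has_field_derivative_def)
qed

lemma partial_deriv_eqI:
  "((\<lambda>t. f (x + t *\<^sub>R axis i 1)) has_real_derivative D) (at 0) \<Longrightarrow> partial_deriv i f x = D"
  unfolding partial_deriv_def by (rule DERIV_imp_deriv)

lemma differentiable_imp_partial:
  assumes "f differentiable_on UNIV"
  shows "((\<lambda>t. f (x + t *\<^sub>R axis i 1)) has_real_derivative partial_deriv i f x) (at 0)"
proof -
  obtain f' where "(f has_derivative f') (at x)"
    using assms by (auto simp: differentiable_on_def differentiable_def)
  from frechet_imp_partial[OF this, of i] partial_deriv_eqI[OF frechet_imp_partial[OF this, of i]]
  show ?thesis by simp
qed

text \<open>\<open>partial_deriv\<close> only speaks of the parameter 0 on a line. Recentring the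
  line carries such a derivative to any parameter \<open>s\<close>, as the mean value theorem and
  the Leibniz rule require.\<close>

lemma line_deriv_shift:
  fixes f :: "real^'n \<Rightarrow> real"
  assumes "((\<lambda>t. f (x + s *\<^sub>R axis i 1 + t *\<^sub>R axis i 1)) has_real_derivative D) (at 0)"
  shows "((\<lambda>t. f (x + t *\<^sub>R axis i 1)) has_real_derivative D) (at s)"
proof -
  have "(\<lambda>t. f (x + s *\<^sub>R axis i 1 + t *\<^sub>R axis i 1)) = (\<lambda>t. f (x + (t + s) *\<^sub>R axis i 1))"
    by (simp add: scaleR_add_left add_ac)
  with assms show ?thesis
    using DERIV_shift[of "\<lambda>t. f (x + t *\<^sub>R axis i 1)" D 0 s] by simp
qed

text \<open>Along a coordinate line the squared norm is a quadratic polynomial in \<open>t\<close>,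
  so radial functions are differentiated by a one-variable chain rule.\<close>

lemma inner_line:
  fixes z :: "real^'n"
  shows "(z + t *\<^sub>R axis i 1) \<bullet> (z + t *\<^sub>R axis i 1) = z \<bullet> z + 2 * t * (z $ i) + t * t"
  by (simp add: inner_add_left inner_add_right inner_axis inner_axis' algebra_simps)

section \<open>Smooth functions, their Laplacians and dilations\<close>

lemma smooth_partial: "smooth f \<Longrightarrow> smooth (partial_deriv i f)"
proof -
  assume "smooth f"
  then have "C_times (Suc k) f" for k
    unfolding smooth_def by (rule spec)
  then show ?thesis by (simp add: smooth_def)
qed

lemma smooth_differentiable: "smooth f \<Longrightarrow> f differentiable_on UNIV"
  unfolding smooth_def by (drule spec[of _ "Suc 0"]) simp

lemma smooth_continuous: "smooth f \<Longrightarrow> continuous_on UNIV f"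
  unfolding smooth_def by (drule spec[of _ 0]) simp

lemma smooth_line_deriv:
  assumes "smooth f"
  shows "((\<lambda>t. f (x + t *\<^sub>R axis i 1)) has_real_derivative partial_deriv i f (x + s *\<^sub>R axis i 1)) (at s)"
  by (rule line_deriv_shift[OF differentiable_imp_partial[OF smooth_differentiable[OF assms]]])

lemma continuous_laplacian: "smooth f \<Longrightarrow> continuous_on UNIV (laplacian f)"
  unfolding laplacian_def[abs_def]
  by (rule continuous_on_sum) (simp add: smooth_continuous smooth_partial)

lemma partial_deriv_scale:
  assumes "f differentiable_on UNIV"
  shows "partial_deriv i (\<lambda>x. a * f (d *\<^sub>R x)) = (\<lambda>x. (a * d) * partial_deriv i f (d *\<^sub>R x))"
proof
  fix x
  have "((\<lambda>t. f (d *\<^sub>R x + t *\<^sub>R axis i 1)) has_real_derivative partial_deriv i f (d *\<^sub>R x)) (at (d * 0))"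
    using differentiable_imp_partial[OF assms] by simp
  from DERIV_cmult[OF DERIV_chain2[OF this DERIV_cmult_Id], of a]
  show "partial_deriv i (\<lambda>x. a * f (d *\<^sub>R x)) x = (a * d) * partial_deriv i f (d *\<^sub>R x)"
    by (intro partial_deriv_eqI) (simp add: algebra_simps)
qed

lemma C_times_scale: "C_times k f \<Longrightarrow> C_times k (\<lambda>x. a * f (d *\<^sub>R x))"
\<comment> \<open>The prefactor is generalised because each derivative turns \<open>a\<close> into
  \<open>a * d\<close>.\<close>
proof (induction k arbitrary: f a)
  case 0
  then have "continuous_on UNIV (\<lambda>x. f (d *\<^sub>R x))"
    by (auto intro!: continuous_on_compose2[of UNIV f] continuous_intros)
  then show ?case by (auto intro!: continuous_intros)
next
  case (Suc k)
  then have f: "f differentiable_on UNIV" and p: "\<And>i. C_times k (partial_deriv i f)" by auto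
  have "(\<lambda>x. f (d *\<^sub>R x)) differentiable_on UNIV"
    using f by (intro differentiable_on_compose[of "\<lambda>x. d *\<^sub>R x" UNIV f])
      (auto intro: differentiable_on_subset derivative_intros)
  moreover have "C_times k (partial_deriv i (\<lambda>x. a * f (d *\<^sub>R x)))" for i
    unfolding partial_deriv_scale[OF f] by (rule Suc.IH[OF p])
  ultimately show ?case by (auto intro!: derivative_intros)
qed

lemma smooth_scale: "smooth f \<Longrightarrow> smooth (\<lambda>x. a * f (d *\<^sub>R x))"
  by (simp add: smooth_def C_times_scale)

lemma laplacian_scale:
  assumes "smooth f"
  shows "laplacian (\<lambda>x. a * f (d *\<^sub>R x)) x = a * d\<^sup>2 * laplacian f (d *\<^sub>R x)"
  unfolding laplacian_def partial_deriv_scale[OF smooth_differentiable[OF assms]]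
    partial_deriv_scale[OF smooth_differentiable[OF smooth_partial[OF assms]]]
  by (simp add: sum_distrib_left power2_eq_square mult.assoc)

text \<open>If \<open>D > 0\<close>, then \<open>g'\<close> vanishes at 0 and is positive just to
  the right of it, so the mean value theorem gives \<open>g h > g 0\<close> for small
  \<open>h > 0\<close>.\<close>

lemma second_derivative_nonpos_at_max:
  fixes g g' :: "real \<Rightarrow> real"
  assumes g: "\<And>t. (g has_real_derivative g' t) (at t)" and g': "(g' has_real_derivative D) (at 0)"
    and max: "e > 0" "\<And>t. \<bar>t\<bar> < e \<Longrightarrow> g t \<le> g 0"
  shows "D \<le> 0"
proof (rule ccontr)
  assume "\<not> D \<le> 0"
  then have D: "D > 0" by simp
  have "g' 0 = 0"
    using DERIV_local_max[OF g max(1)] max(2) by simp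
  then obtain a where a: "a > 0" "\<And>h. 0 < h \<Longrightarrow> h < a \<Longrightarrow> 0 < g' h"
    using DERIV_pos_inc_right[OF g' D] by auto
  define h where "h = min a e / 2"
  have h: "0 < h" "h < a" "h < e" using a(1) max(1) by (auto simp: h_def)
  obtain z where z: "0 < z" "z < h" "g h - g 0 = (h - 0) * g' z"
    using MVT2[of 0 h g g'] h(1) g by auto
  then have "0 < h * g' z" using a(2)[of z] h by simp
  then show False using max(2)[of h] h z by simp
qed

text \<open>The perturbation by \<open>\<delta> \<bar>x\<bar>\<^sup>2\<close> makes the Laplacian strictly negative at an interior maximum.\<close>

lemma comparison_principle:
  fixes u v :: "real^3 \<Rightarrow> real"
  assumes u: "smooth u" "(u \<longlongrightarrow> a) at_infinity" and v: "smooth v" "(v \<longlongrightarrow> b) at_infinity"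
    and ab: "a \<le> b + e"
    and sub: "\<And>x. u x > v x + e \<Longrightarrow> laplacian u x \<ge> laplacian v x"
  shows "u x \<le> v x + e"
proof (rule ccontr)
  define w where "w = (\<lambda>x. u x - v x - e)"
  assume "\<not> u x \<le> v x + e"
  then have M: "w x > 0" by (simp add: w_def)
  define M where "M = w x"
  have "(w \<longlongrightarrow> a - b - e) at_infinity"
    unfolding w_def by (intro tendsto_intros u v)
  then have "eventually (\<lambda>y. w y < M / 4) at_infinity"
    using M ab by (intro order_tendstoD(2)) (auto simp: M_def)
  then obtain R0 where R0: "\<And>y. norm y \<ge> R0 \<Longrightarrow> w y < M / 4"
    by (auto simp: eventually_at_infinity)
  define R where "R = max R0 (norm x) + 1"
  have R: "R > 0" "norm x < R" and wR: "\<And>y. norm y \<ge> R \<Longrightarrow> w y < M / 4"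
    using R0 norm_ge_zero[of x] unfolding R_def by (linarith, linarith, simp)
  \<comment> \<open>With this \<delta> the perturbation is at most M / 4 on the ball. Hence
    \<open>w\<close> is at least 3 M / 4 at the maximiser of \<open>q\<close>, while it is below M /
    4 on the sphere, so the maximiser is interior.\<close>
  define \<delta> where "\<delta> = M / (4 * R\<^sup>2)"
  have \<delta>: "\<delta> > 0" "\<delta> * R\<^sup>2 = M / 4" using M R by (auto simp: \<delta>_def M_def)
  define q where "q = (\<lambda>y. w y + \<delta> * (y \<bullet> y))"
  have "continuous_on (cball 0 R) q"
    unfolding q_def w_def
    by (intro continuous_intros continuous_on_subset[OF smooth_continuous[OF u(1)]]
        continuous_on_subset[OF smooth_continuous[OF v(1)]]) auto
  then obtain y where y: "norm y \<le> R" and ymax: "\<And>z. norm z \<le> R \<Longrightarrow> q z \<le> q y"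
    using continuous_attains_sup[of "cball 0 R" q] R by auto
  have yy: "\<delta> * (y \<bullet> y) \<le> M / 4"
    using mult_left_mono[OF power_mono[OF y norm_ge_zero, of 2] less_imp_le[OF \<delta>(1)]] \<delta>(2)
    by (simp add: power2_norm_eq_inner)
  have "M \<le> q x" using \<delta>(1) by (simp add: q_def M_def)
  also have "\<dots> \<le> q y" using R by (intro ymax) simp
  finally have wy: "w y \<ge> 3 * M / 4" using yy by (simp add: q_def)
  then have "norm y < R" using wR[of y] M by (force simp: M_def)
  have "partial_deriv i (partial_deriv i u) y - partial_deriv i (partial_deriv i v) y + 2 * \<delta> \<le> 0" for i
  proof -
    define g where "g t = q (y + t *\<^sub>R axis i 1)" for t
    define g' where "g' t = partial_deriv i u (y + t *\<^sub>R axis i 1) - partial_deriv i v (y + t *\<^sub>R axis i 1)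
        + \<delta> * (2 * (y $ i) + 2 * t)" for t
    have "(g has_real_derivative g' t) (at t)" for t
      unfolding g_def q_def w_def g'_def inner_line
      by (auto intro!: derivative_eq_intros smooth_line_deriv u v)
    moreover have "(g' has_real_derivative partial_deriv i (partial_deriv i u) y
        - partial_deriv i (partial_deriv i v) y + 2 * \<delta>) (at 0)"
      unfolding g'_def
      by (auto intro!: derivative_eq_intros differentiable_imp_partial smooth_differentiable smooth_partial u v)
    moreover have "g t \<le> g 0" if "\<bar>t\<bar> < R - norm y" for t
    proof -
      have "norm (y + t *\<^sub>R axis i 1) \<le> R"
        using norm_triangle_ineq[of y "t *\<^sub>R axis i 1"] that by (simp add: norm_axis_1)
      then show ?thesis using ymax by (simp add: g_def)
    qed
    ultimately show ?thesis
      using second_derivative_nonpos_at_max[of g g' _ "R - norm y"] \<open>norm y < R\<close> by auto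
  qed
  \<comment> \<open>The three directions add up to the difference of the Laplacians plus 6 \<delta>,
    so the Laplacian of \<open>u\<close> is strictly smaller at \<open>y\<close>, against
    \<open>sub\<close>.\<close>
  then have "(\<Sum>i\<in>UNIV. partial_deriv i (partial_deriv i u) y - partial_deriv i (partial_deriv i v) y + 2 * \<delta>) \<le> 0"
    by (intro sum_nonpos) auto
  then have "laplacian u y < laplacian v y"
    using \<delta>(1) by (simp add: laplacian_def sum.distrib sum_subtractf)
  moreover have "u y > v y + e" using wy M by (simp add: w_def M_def)
  ultimately show False using sub[of y] by simp
qed

section \<open>Green's identity\<close>

lemma integrable_compact_support:
  fixes f :: "'a::euclidean_space \<Rightarrow> real"
  assumes "continuous_on UNIV f" "\<And>x. norm x > R \<Longrightarrow> f x = 0"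
  shows "integrable lborel f"
proof -
  have "integrable lborel (\<lambda>x. indicator (cball 0 R) x *\<^sub>R f x)"
    using assms(1) by (intro borel_integrable_compact) (auto intro: continuous_on_subset)
  moreover have "(\<lambda>x. indicator (cball 0 R) x *\<^sub>R f x) = f"
    using assms(2) by (auto simp: fun_eq_iff indicator_def not_le[symmetric])
  ultimately show ?thesis by simp
qed

text \<open>Passes from the Lebesgue integral over the whole space to the gauge integral over a box,
  the form to which the Leibniz rule applies.\<close>

lemma has_integral_superset_support:
  fixes f :: "'a::euclidean_space \<Rightarrow> real"
  assumes "integrable lborel f" "\<And>x. x \<notin> S \<Longrightarrow> f x = 0"
  shows "(f has_integral integral\<^sup>L lborel f) S"
proof -
  have "(\<lambda>x. if x \<in> S then f x else 0) = f"
    using assms(2) by (auto simp: fun_eq_iff)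
  then show ?thesis
    using has_integral_integral_lborel[OF assms(1)] has_integral_restrict_UNIV[of S f] by simp
qed

lemma lborel_integral_translate:
  fixes f :: "'a::euclidean_space \<Rightarrow> real"
  assumes "f \<in> borel_measurable borel"
  shows "(LINT x|lborel. f (x + c)) = integral\<^sup>L lborel f"
proof -
  have "integral\<^sup>L lborel f = integral\<^sup>L (distr lborel borel ((+) c)) f"
    by (simp add: lborel_distr_plus)
  also have "\<dots> = (LINT x|lborel. f (c + x))"
    using assms by (intro integral_distr) auto
  finally show ?thesis by (simp add: add.commute)
qed

lemma lborel_integral_affine:
  fixes f :: "'a::euclidean_space \<Rightarrow> real"
  assumes f: "f \<in> borel_measurable borel" and R: "R > 0"
  shows "integral\<^sup>L lborel f = R ^ DIM('a) * (LINT z|lborel. f (x + R *\<^sub>R z))"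
proof -
  have "integral\<^sup>L lborel f =
      integral\<^sup>L (density (distr lborel borel (\<lambda>z. x + R *\<^sub>R z)) (\<lambda>_. \<bar>R\<bar> ^ DIM('a))) f"
    using R by (subst lborel_affine[of R x]) auto
  also have "\<dots> = (LINT z|distr lborel borel (\<lambda>z. x + R *\<^sub>R z). (\<bar>R\<bar> ^ DIM('a)) *\<^sub>R f z)"
    using f by (intro integral_density) auto
  also have "\<dots> = (LINT z|lborel. (\<bar>R\<bar> ^ DIM('a)) *\<^sub>R f (x + R *\<^sub>R z))"
    using f by (intro integral_distr) auto
  finally show ?thesis using R by simp
qed

text \<open>The derivative of the constant \<open>h \<mapsto> \<integral> F (x + h e\<^sub>i) dx\<close> at \<open>0\<close>.\<close>

lemma integral_line_deriv_eq_0: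
  fixes F F' :: "real^'n \<Rightarrow> real"
  assumes F: "\<And>x. ((\<lambda>t. F (x + t *\<^sub>R axis i 1)) has_real_derivative F' x) (at 0)"
    and cont: "continuous_on UNIV F" "continuous_on UNIV F'"
    and supp: "\<And>x. norm x > R \<Longrightarrow> F x = 0" "\<And>x. norm x > R \<Longrightarrow> F' x = 0"
  shows "integral\<^sup>L lborel F' = 0"
proof -
  define e where "e = (axis i 1 :: real^'n)"
  have e: "norm e = 1" by (simp add: e_def norm_axis_1)
  \<comment> \<open>The margin 1 keeps the support of every translate of \<open>F\<close> by |h| < 1
    inside one fixed box.\<close>
  obtain a where a: "cball 0 (R + 1) \<subseteq> cbox (-a) (a :: real^'n)"
    using bounded_subset_cbox_symmetric[OF bounded_cball] .
  have F0: "F (y + h *\<^sub>R e) = 0" if "y \<notin> cbox (-a) a" "\<bar>h\<bar> < 1" for y h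
  proof -
    have "norm y > R + 1" using a that by (auto simp: subset_iff not_le[symmetric])
    then show ?thesis
      using that e norm_triangle_ineq2[of y "- (h *\<^sub>R e)"] by (intro supp) simp
  qed
  have int: "((\<lambda>y. F (y + h *\<^sub>R e)) has_integral integral\<^sup>L lborel F) (cbox (-a) a)" if h: "\<bar>h\<bar> < 1" for h
  proof -
    have c: "continuous_on UNIV (\<lambda>y. F (y + h *\<^sub>R e))"
      by (auto intro!: continuous_on_compose2[OF cont(1)] continuous_intros)
    have "F (y + h *\<^sub>R e) = 0" if "norm y > R + 1" for y
      using that e h norm_triangle_ineq2[of y "- (h *\<^sub>R e)"] by (intro supp) simp
    then have "integrable lborel (\<lambda>y. F (y + h *\<^sub>R e))"
      by (rule integrable_compact_support[OF c])
    from has_integral_superset_support[OF this F0, of "cbox (-a) a"] h show ?thesis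
      by (simp add: lborel_integral_translate borel_measurable_continuous_onI[OF cont(1)])
  qed
  have "((\<lambda>h. integral (cbox (-a) a) (\<lambda>y. F (y + h *\<^sub>R e))) has_real_derivative
      integral (cbox (-a) a) (\<lambda>y. F' (y + 0 *\<^sub>R e))) (at 0 within {-1<..<1})"
  proof (rule leibniz_rule_field_derivative)
    fix h :: real and y :: "real^'n"
    show "((\<lambda>h. F (y + h *\<^sub>R e)) has_real_derivative F' (y + h *\<^sub>R e)) (at h within {-1<..<1})"
      unfolding e_def by (rule has_field_derivative_at_within[OF line_deriv_shift[OF F]])
  next
    show "continuous_on ({-1<..<1} \<times> cbox (-a) a) (\<lambda>(h, y). F' (y + h *\<^sub>R e))"
      unfolding case_prod_unfold
      by (rule continuous_on_compose2[OF cont(2)]) (auto intro!: continuous_intros)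
  next
    fix h :: real
    assume "h \<in> {-1<..<1}"
    then show "(\<lambda>y. F (y + h *\<^sub>R e)) integrable_on cbox (-a) a"
      by (intro has_integral_integrable[OF int]) auto
  qed auto
  then have "((\<lambda>h. integral (cbox (-a) a) (\<lambda>y. F (y + h *\<^sub>R e))) has_real_derivative
      integral (cbox (-a) a) F') (at 0)"
    by (simp add: at_within_open[of 0 "{-1<..<1::real}"])
  \<comment> \<open>By translation invariance the function differentiated above is constant near 0,
    so its derivative is also 0.\<close>
  moreover have "integral\<^sup>L lborel F = integral (cbox (-a) a) (\<lambda>y. F (y + h *\<^sub>R e))" if "h \<in> {-1<..<1}" for h
    by (rule integral_unique[OF int, symmetric]) (use that in auto)
  then have "((\<lambda>h. integral (cbox (-a) a) (\<lambda>y. F (y + h *\<^sub>R e))) has_real_derivative 0) (at 0)"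
    by (rule has_field_derivative_transform_within_open[of "\<lambda>_. integral\<^sup>L lborel F" _ _ "{-1<..<1}", rotated 3]) auto
  ultimately have "integral (cbox (-a) a) F' = 0"
    by (rule DERIV_unique)
  moreover have "F' x = 0" if "x \<notin> cbox (-a) a" for x
  proof (rule supp(2))
    from that a have "\<not> norm x \<le> R + 1" by auto
    then show "norm x > R" by simp
  qed
  then have "(F' has_integral integral\<^sup>L lborel F') (cbox (-a) a)"
    by (intro has_integral_superset_support[OF integrable_compact_support[OF cont(2) supp(2)]])
  ultimately show ?thesis by (simp add: integral_unique)
qed

text \<open>In each direction the difference of the integrands is the i-th derivative of \<psi>
  times the i-th derivative of \<open>u\<close> minus \<open>u\<close> times
  \<open>\<psi>1 i\<close>, a compactly supported function, so it integrates to 0. The derivatives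
  of \<psi> are explicit data and only of second order, because the kernels inserted later are
  merely C^2.\<close>

lemma green_identity:
  fixes u \<psi> :: "real^3 \<Rightarrow> real"
  assumes u: "smooth u"
    and d1: "\<And>i x. ((\<lambda>t. \<psi> (x + t *\<^sub>R axis i 1)) has_real_derivative \<psi>1 i x) (at 0)"
    and d2: "\<And>i x. ((\<lambda>t. \<psi>1 i (x + t *\<^sub>R axis i 1)) has_real_derivative \<psi>2 i x) (at 0)"
    and cont: "continuous_on UNIV \<psi>" "\<And>i. continuous_on UNIV (\<psi>1 i)" "\<And>i. continuous_on UNIV (\<psi>2 i)"
    and supp: "\<And>x. norm x > R \<Longrightarrow> \<psi> x = 0" "\<And>i x. norm x > R \<Longrightarrow> \<psi>1 i x = 0"
      "\<And>i x. norm x > R \<Longrightarrow> \<psi>2 i x = 0"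
  shows "(LINT x|lborel. \<psi> x * laplacian u x) = (LINT x|lborel. u x * (\<Sum>i\<in>UNIV. \<psi>2 i x))"
proof -
  note smc = smooth_continuous[OF u] smooth_continuous[OF smooth_partial[OF u]]
    smooth_continuous[OF smooth_partial[OF smooth_partial[OF u]]]
  note smd = differentiable_imp_partial[OF smooth_differentiable[OF u]]
    differentiable_imp_partial[OF smooth_differentiable[OF smooth_partial[OF u]]]
  define F where "F i x = \<psi> x * partial_deriv i (partial_deriv i u) x - u x * \<psi>2 i x" for i x
  have "integral\<^sup>L lborel (F i) = 0" for i
  proof (rule integral_line_deriv_eq_0[where R = R])
    fix x
    show "((\<lambda>t. \<psi> (x + t *\<^sub>R axis i 1) * partial_deriv i u (x + t *\<^sub>R axis i 1)
        - u (x + t *\<^sub>R axis i 1) * \<psi>1 i (x + t *\<^sub>R axis i 1)) has_real_derivative F i x) (at 0)"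
      by (rule DERIV_cong[OF DERIV_diff[OF DERIV_mult[OF d1 smd(2)] DERIV_mult[OF smd(1) d2]]])
        (simp add: F_def)
  next
    show "continuous_on UNIV (\<lambda>x. \<psi> x * partial_deriv i u x - u x * \<psi>1 i x)"
      by (intro continuous_intros cont smc)
    show "continuous_on UNIV (F i)"
      unfolding F_def by (intro continuous_intros cont smc)
  qed (use supp in \<open>auto simp: F_def\<close>)
  moreover have "integrable lborel (F i)" for i
    by (rule integrable_compact_support[of _ R])
      (use supp in \<open>auto simp: F_def intro!: continuous_intros cont smc\<close>)
  ultimately have "(LINT x|lborel. (\<Sum>i\<in>UNIV. F i x)) = 0"
    by (simp add: Bochner_Integration.integral_sum)
  moreover have "(\<Sum>i\<in>UNIV. F i x) = \<psi> x * laplacian u x - u x * (\<Sum>i\<in>UNIV. \<psi>2 i x)" for x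
    by (simp add: F_def laplacian_def sum_subtractf sum_distrib_left)
  moreover have "integrable lborel (\<lambda>x. \<psi> x * laplacian u x)"
    by (rule integrable_compact_support[of _ R])
      (use supp in \<open>auto intro!: continuous_intros cont continuous_laplacian u\<close>)
  moreover have "integrable lborel (\<lambda>x. u x * (\<Sum>i\<in>UNIV. \<psi>2 i x))"
    by (rule integrable_compact_support[of _ R])
      (use supp in \<open>auto intro!: continuous_intros cont smc\<close>)
  ultimately show ?thesis by simp
qed

text \<open>Layer-cake argument: on the unit ball 1 - |z|^2 is the integral of 2 r over r from |z|
  to 1. Exchanging the integrals leaves the ball volumes 4/3 pi r^3 weighted by 2 r, whose integral
  over [0, 1] is 8 pi / 15.\<close>

lemma integral_one_minus_norm_sq:
  "has_bochner_integral lborel (\<lambda>z::real^3. max 0 (1 - z \<bullet> z)) (8 * pi / 15)"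
proof (rule has_bochner_integral_nn_integral)
  let ?I = "\<lambda>(z::real^3) r. ennreal (2 * r) * indicator {norm z..1} r"
  have "(\<integral>\<^sup>+ z. ennreal (max 0 (1 - z \<bullet> (z::real^3))) \<partial>lborel) = (\<integral>\<^sup>+ z. (\<integral>\<^sup>+ r. ?I z r \<partial>lborel) \<partial>lborel)"
  proof (rule nn_integral_cong)
    fix z :: "real^3"
    show "ennreal (max 0 (1 - z \<bullet> z)) = (\<integral>\<^sup>+ r. ?I z r \<partial>lborel)"
    proof (cases "norm z \<le> 1")
      case True
      have "(\<integral>\<^sup>+ r. ?I z r \<partial>lborel) = 1\<^sup>2 - (norm z)\<^sup>2"
        using True norm_ge_zero[of z]
        by (intro nn_integral_FTC_Icc[where F = "\<lambda>r. r\<^sup>2"])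
          (auto intro!: derivative_eq_intros order_trans[OF norm_ge_zero])
      also have "1\<^sup>2 - (norm z)\<^sup>2 = max 0 (1 - z \<bullet> z)"
        using True by (simp add: power2_norm_eq_inner[symmetric] power_le_one)
      finally show ?thesis ..
    next
      case False
      then have "1 \<le> norm z ^ 2" by (simp add: one_le_power)
      then have "max 0 (1 - z \<bullet> z) = 0" by (simp add: power2_norm_eq_inner[symmetric])
      then show ?thesis using False by simp
    qed
  qed
  also have "\<dots> = (\<integral>\<^sup>+ r. (\<integral>\<^sup>+ z. ?I z r \<partial>lborel) \<partial>lborel)"
  proof (rule lborel_pair.Fubini'[symmetric])
    have "(\<lambda>(z::real^3, r::real). ?I z r) = (\<lambda>p. ennreal (2 * snd p) * indicator {p. norm (fst p) \<le> snd p \<and> snd p \<le> 1} p)"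
      by (auto simp: fun_eq_iff indicator_def)
    also have "\<dots> \<in> borel_measurable (lborel \<Otimes>\<^sub>M lborel)"
      by measurable
    finally show "(\<lambda>(z::real^3, r::real). ?I z r) \<in> borel_measurable (lborel \<Otimes>\<^sub>M lborel)" .
  qed
  also have "\<dots> = (\<integral>\<^sup>+ r. ennreal (8 * pi / 3 * r ^ 4) * indicator {0..1} r \<partial>lborel)"
  proof (rule nn_integral_cong)
    fix r :: real
    show "(\<integral>\<^sup>+ z. ?I z r \<partial>lborel) = ennreal (8 * pi / 3 * r ^ 4) * indicator {0..1} r"
    proof (cases "r \<in> {0..1}")
      case True
      then have "(\<integral>\<^sup>+ z. ?I z r \<partial>lborel) = (\<integral>\<^sup>+ z. ennreal (2 * r) * indicator (cball (0::real^3) r) z \<partial>lborel)"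
        by (intro nn_integral_cong) (auto simp: indicator_def)
      also have "\<dots> = ennreal (2 * r) * emeasure lborel (cball (0::real^3) r)"
        by (rule nn_integral_cmult_indicator) simp
      also have "emeasure lborel (cball (0::real^3) r) = ennreal (4 / 3 * pi * r ^ 3)"
        using True by (simp add: emeasure_cball unit_ball_vol_3)
      also have "ennreal (2 * r) * \<dots> = ennreal (2 * r * (4 / 3 * pi * r ^ 3))"
        using True by (intro ennreal_mult'[symmetric]) simp
      also have "2 * r * (4 / 3 * pi * r ^ 3) = 8 * pi / 3 * r ^ 4"
        by (simp add: eval_nat_numeral)
      finally show ?thesis using True by simp
    next
      case False
      then have "?I z r = 0" for z
        using order_trans[OF norm_ge_zero, of z r] by (auto simp: indicator_def)
      then have "(\<lambda>z. ?I z r) = (\<lambda>_. 0)" by (intro ext)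
      then show ?thesis using False by simp
    qed
  qed
  also have "\<dots> = ennreal (8 * pi / 15 * 1 ^ 5 - 8 * pi / 15 * 0 ^ 5)"
    by (intro nn_integral_FTC_Icc) (auto intro!: derivative_eq_intros)
  finally show "(\<integral>\<^sup>+ z. ennreal (max 0 (1 - z \<bullet> (z::real^3))) \<partial>lborel) = ennreal (8 * pi / 15)"
    by simp
qed auto

section \<open>The regularised Newtonian kernel\<close>

text \<open>The closures of the two pieces meet only at \<open>a\<close>, where \<open>eq\<close>
  matches both values and derivatives.\<close>

lemma has_real_derivative_If_le:
  fixes f g :: "real \<Rightarrow> real"
  assumes f: "\<And>x. x \<le> a \<Longrightarrow> (f has_real_derivative f' x) (at x)"
    and g: "\<And>x. a \<le> x \<Longrightarrow> (g has_real_derivative g' x) (at x)"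
    and eq: "f a = g a" "f' a = g' a"
  shows "((\<lambda>x. if x \<le> a then f x else g x) has_real_derivative (if x \<le> a then f' x else g' x)) (at x)"
proof -
  have "((\<lambda>x. if x \<in> {..a} then f x else g x) has_vector_derivative
      (if x \<in> {..a} then f' x else g' x)) (at x within UNIV)"
    using f g eq
    by (intro has_vector_derivative_If_within_closures[where T = "{a<..}"])
      (auto simp: has_real_derivative_iff_has_vector_derivative[symmetric] closure_greaterThan
        intro: has_field_derivative_at_within)
  then show ?thesis
    by (simp add: has_real_derivative_iff_has_vector_derivative)
qed

text \<open>A \<open>C\<^sup>2\<close> function of \<open>s = |z|\<^sup>2\<close> that agrees with \<open>1 / |z|\<close> for \<open>s \<ge> 1\<close>: the quadratic
  polynomial is the Taylor polynomial of \<open>s\<^bsup>-1/2\<^esup>\<close> at \<open>s = 1\<close>.\<close>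

definition kern :: "real \<Rightarrow> real" where
  "kern s = (if s \<le> 1 then 15 / 8 - 5 / 4 * s + 3 / 8 * s\<^sup>2 else 1 / sqrt s)"

definition kern' :: "real \<Rightarrow> real" where
  "kern' s = (if s \<le> 1 then - 5 / 4 + 3 / 4 * s else - inverse (2 * s * sqrt s))"

definition kern'' :: "real \<Rightarrow> real" where
  "kern'' s = (if s \<le> 1 then 3 / 4 else 3 / (4 * s\<^sup>2 * sqrt s))"

lemma kern_deriv: "(kern has_real_derivative kern' s) (at s)"
proof -
  have "((\<lambda>s. 1 / sqrt s) has_real_derivative - inverse (2 * s * sqrt s)) (at s)" if "1 \<le> s" for s
    using that by (auto intro!: derivative_eq_intros simp: divide_simps)
  then show ?thesis
    unfolding kern_def[abs_def] kern'_def
    by (intro has_real_derivative_If_le) (auto intro!: derivative_eq_intros)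
qed

lemma kern'_deriv: "(kern' has_real_derivative kern'' s) (at s)"
proof -
  have "((\<lambda>s. - inverse (2 * s * sqrt s)) has_real_derivative 3 / (4 * s\<^sup>2 * sqrt s)) (at s)" if s: "1 \<le> s" for s
  proof -
    have "((\<lambda>s. 2 * s * sqrt s) has_real_derivative 3 * sqrt s) (at s)"
      using s by (auto intro!: derivative_eq_intros simp: divide_simps real_sqrt_mult_self)
    from DERIV_minus[OF DERIV_inverse_fun[OF this]] s
    have "((\<lambda>s. - inverse (2 * s * sqrt s)) has_real_derivative
        3 * sqrt s * inverse ((2 * s * sqrt s) ^ Suc (Suc 0))) (at s)"
      by (simp only: minus_minus) simp
    moreover have "3 * sqrt s * inverse ((2 * s * sqrt s) ^ Suc (Suc 0)) = 3 / (4 * s\<^sup>2 * sqrt s)"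
    proof -
      \<comment> \<open>Substituting s = r * r turns the claim into an identity of rational
        functions.\<close>
      define r where "r = sqrt s"
      have "r > 0" "sqrt s = r" "s = r * r" using s by (auto simp: r_def)
      then show ?thesis by (simp add: divide_simps power2_eq_square)
    qed
    ultimately show ?thesis by (rule DERIV_cong)
  qed
  then show ?thesis
    unfolding kern'_def[abs_def] kern''_def
    by (intro has_real_derivative_If_le) (auto intro!: derivative_eq_intros)
qed

lemma continuous_kern: "continuous_on UNIV kern" "continuous_on UNIV kern'" "continuous_on UNIV kern''"
proof -
  show "continuous_on UNIV kern" "continuous_on UNIV kern'"
    using kern_deriv kern'_deriv
    by (auto intro!: continuous_at_imp_continuous_on intro: DERIV_isCont)
  have "continuous_on ({..1} \<union> {1..}) kern''"
    unfolding kern''_def[abs_def]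
    by (intro continuous_on_If) (auto intro!: continuous_intros)
  moreover have "{..1} \<union> {1..} = (UNIV :: real set)" by auto
  ultimately show "continuous_on UNIV kern''" by simp
qed

lemma kern_nonneg: "0 \<le> kern s"
proof -
  \<comment> \<open>Completing the square, the polynomial branch is 3/8 * (s - 5/3)^2 + 5/6.\<close>
  have "(5 / 3 - s)\<^sup>2 \<ge> 0" by simp
  then show ?thesis by (auto simp: kern_def power2_eq_square algebra_simps)
qed

text \<open>The bound is the value at 0. It makes the kernel of radius \<open>R\<close> uniformly of
  order 1 / R.\<close>

lemma kern_le: assumes "0 \<le> s" shows "kern s \<le> 15 / 8"
proof (cases "s \<le> 1")
  case True
  then have "s\<^sup>2 \<le> s" using assms by (simp add: power2_eq_square mult_left_le)
  with True assms show ?thesis by (simp add: kern_def)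
next
  case False
  then have "1 \<le> sqrt s" by simp
  then have "1 / sqrt s \<le> 1" by simp
  moreover have "kern s = 1 / sqrt s" using False by (simp add: kern_def)
  ultimately show ?thesis by linarith
qed

text \<open>In three dimensions the Laplacian of z \<mapsto> k(|z|^2) is 6 k'(s) + 4 s k''(s) at s =
  |z|^2. It vanishes where the kernel is 1 / |z|, and the second-order matching makes it continuous
  across s = 1.\<close>

lemma laplacian_kern: "6 * kern' s + 4 * s * kern'' s = - 15 / 2 * max 0 (1 - s)"
proof (cases "s \<le> 1")
  case False
  define r where "r = sqrt s"
  have "r > 0" "sqrt s = r" "s = r * r" using False by (auto simp: r_def)
  with False show ?thesis by (simp add: kern'_def kern''_def divide_simps power2_eq_square)
qed (simp add: kern'_def kern''_def field_simps)

text \<open>The function \<open>1 / |z|\<close> on \<open>\<real>\<^sup>3\<close>, regularised inside the ball of radius \<open>R\<close>, and its first and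
  second derivatives in direction \<open>i\<close>.\<close>

definition newton :: "real \<Rightarrow> real^3 \<Rightarrow> real" where
  "newton R z = kern ((z \<bullet> z) / R\<^sup>2) / R"

definition newton1 :: "real \<Rightarrow> 3 \<Rightarrow> real^3 \<Rightarrow> real" where
  "newton1 R i z = 2 * z $ i * kern' ((z \<bullet> z) / R\<^sup>2) / R ^ 3"

definition newton2 :: "real \<Rightarrow> 3 \<Rightarrow> real^3 \<Rightarrow> real" where
  "newton2 R i z = 2 * kern' ((z \<bullet> z) / R\<^sup>2) / R ^ 3 + 4 * (z $ i)\<^sup>2 * kern'' ((z \<bullet> z) / R\<^sup>2) / R ^ 5"

lemma newton_deriv: "((\<lambda>t. newton R (z + t *\<^sub>R axis i 1)) has_real_derivative newton1 R i z) (at 0)"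
    and newton1_deriv: "((\<lambda>t. newton1 R i (z + t *\<^sub>R axis i 1)) has_real_derivative newton2 R i z) (at 0)"
proof -
  have "((\<lambda>t. z \<bullet> z + 2 * t * (z $ i) + t * t) has_real_derivative 2 * z $ i) (at 0)"
    by (auto intro!: derivative_eq_intros)
  note q = DERIV_cdivide[OF this, of "R\<^sup>2"]
  have k: "((\<lambda>t. k ((z \<bullet> z + 2 * t * (z $ i) + t * t) / R\<^sup>2)) has_real_derivative
      k' ((z \<bullet> z) / R\<^sup>2) * (2 * z $ i / R\<^sup>2)) (at 0)"
    if "\<And>s. (k has_real_derivative k' s) (at s)" for k k'
    using DERIV_chain2[OF that q] by simp
  \<comment> \<open>For \<open>R = 0\<close> all quotients are 0, so the identities hold for every
    real \<open>R\<close>.\<close>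
  have alg: "a * (2 * b / R\<^sup>2) / R = 2 * b * a / R ^ 3"
    "(2 * a + c * (2 * b / R\<^sup>2) * (2 * b)) / R ^ 3 = 2 * a / R ^ 3 + 4 * b\<^sup>2 * c / R ^ 5" for a b c :: real
    by (cases "R = 0"; simp add: field_simps eval_nat_numeral)+
  show "((\<lambda>t. newton R (z + t *\<^sub>R axis i 1)) has_real_derivative newton1 R i z) (at 0)"
    unfolding newton_def inner_line
    by (rule DERIV_cong[OF DERIV_cdivide[OF k[OF kern_deriv]]])
      (simp only: newton1_def alg)
  have "((\<lambda>t. 2 * (z $ i + t)) has_real_derivative 2) (at 0)"
    by (auto intro!: derivative_eq_intros)
  then have "((\<lambda>t. 2 * (z + t *\<^sub>R axis i 1) $ i) has_real_derivative 2) (at 0)"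
    by simp
  from DERIV_cdivide[OF DERIV_mult[OF this k[OF kern'_deriv]], of "R ^ 3"]
  show "((\<lambda>t. newton1 R i (z + t *\<^sub>R axis i 1)) has_real_derivative newton2 R i z) (at 0)"
    unfolding newton1_def inner_line
    by (rule DERIV_cong) (simp add: newton2_def alg(2)[symmetric])
qed

lemma continuous_newton:
  "continuous_on UNIV (newton R)" "continuous_on UNIV (newton1 R i)" "continuous_on UNIV (newton2 R i)"
proof -
  have c: "continuous_on UNIV (\<lambda>z::real^3. k ((z \<bullet> z) / R\<^sup>2))"
    if "continuous_on UNIV k" for k :: "real \<Rightarrow> real"
    by (rule continuous_on_compose2[OF that]) (auto simp: divide_inverse intro!: continuous_intros)
  \<comment> \<open>Dividing by a constant is multiplying by its inverse, which covers
    \<open>R = 0\<close> as well.\<close>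
  have continuous_on_divide_const: "continuous_on UNIV (\<lambda>z. f z / c)"
    if "continuous_on UNIV f" for f :: "real^3 \<Rightarrow> real" and c
    unfolding divide_inverse by (intro continuous_intros that)
  note [continuous_intros] = c[OF continuous_kern(1)] c[OF continuous_kern(2)] c[OF continuous_kern(3)]
  show "continuous_on UNIV (newton R)" "continuous_on UNIV (newton1 R i)" "continuous_on UNIV (newton2 R i)"
    unfolding newton_def[abs_def] newton1_def[abs_def] newton2_def[abs_def]
    by (intro continuous_intros continuous_on_divide_const)+
qed

text \<open>Nothing on the right depends on \<open>R\<close>. Hence the difference of two
  regularised kernels, together with its derivatives, vanishes beyond the larger radius.\<close>

lemma newton_outside:
  assumes "0 < R" "R < norm z"
  shows "newton R z = 1 / norm z" "newton1 R i z = - z $ i / norm z ^ 3"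
    "newton2 R i z = - 1 / norm z ^ 3 + 3 * (z $ i)\<^sup>2 / norm z ^ 5"
proof -
  define q where "q = norm z / R"
  have q: "q > 1" and z: "norm z = q * R" using assms by (auto simp: q_def)
  then have q2: "\<not> q\<^sup>2 \<le> 1" "sqrt (q\<^sup>2) = q" by (auto simp: not_le one_less_power)
  have k: "kern (q\<^sup>2) = 1 / q" "kern' (q\<^sup>2) = - 1 / (2 * q ^ 3)" "kern'' (q\<^sup>2) = 3 / (4 * q ^ 5)"
    unfolding kern_def kern'_def kern''_def using q q2 by (simp_all add: divide_simps eval_nat_numeral)
  have s: "(z \<bullet> z) / R\<^sup>2 = q\<^sup>2"
    using assms by (simp add: power2_norm_eq_inner[symmetric] z power_mult_distrib)
  show "newton R z = 1 / norm z" "newton1 R i z = - z $ i / norm z ^ 3"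
    "newton2 R i z = - 1 / norm z ^ 3 + 3 * (z $ i)\<^sup>2 / norm z ^ 5"
    unfolding newton_def newton1_def newton2_def s k z
    using q assms(1) by (simp_all add: field_simps eval_nat_numeral)
qed

text \<open>For \<open>R > 0\<close> the Laplacian of the regularised kernel is a bump on the ball
  of radius \<open>R\<close> with total mass -15/2 * 8 pi / 15 = -4 pi, an approximation of -4 pi
  times the Dirac measure.\<close>

lemma sum_newton2:
  "(\<Sum>i\<in>UNIV. newton2 R i z) = - 15 / 2 * max 0 (1 - (z \<bullet> z) / R\<^sup>2) / R ^ 3"
proof -
  have sq: "(\<Sum>i\<in>UNIV. (z $ i)\<^sup>2) = z \<bullet> z"
    by (simp add: inner_vec_def power2_eq_square)
  have "(\<Sum>i\<in>UNIV. newton2 R i z) =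
      6 * kern' ((z \<bullet> z) / R\<^sup>2) / R ^ 3 + 4 * (z \<bullet> z) * kern'' ((z \<bullet> z) / R\<^sup>2) / R ^ 5"
    by (simp add: newton2_def sum.distrib sq flip: sum_distrib_left sum_distrib_right sum_divide_distrib)
  also have "\<dots> = (6 * kern' ((z \<bullet> z) / R\<^sup>2) + 4 * ((z \<bullet> z) / R\<^sup>2) * kern'' ((z \<bullet> z) / R\<^sup>2)) / R ^ 3"
    by (simp add: add_divide_distrib eval_nat_numeral mult_ac)
  finally show ?thesis unfolding laplacian_kern .
qed

lemma newton_nonneg: "0 \<le> R \<Longrightarrow> 0 \<le> newton R z"
  by (simp add: newton_def kern_nonneg)

lemma newton_le: "0 < R \<Longrightarrow> newton R z \<le> 15 / 8 / R"
  unfolding newton_def by (intro divide_right_mono kern_le) auto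

section \<open>The Newtonian representation\<close>

lemma bounded_if_tendsto_at_infinity:
  fixes u :: "real^'n \<Rightarrow> real"
  assumes c: "continuous_on UNIV u" and L: "(u \<longlongrightarrow> L) at_infinity"
  shows "\<exists>B. \<forall>x. \<bar>u x\<bar> \<le> B"
proof -
  obtain R where R: "\<And>x. norm x \<ge> R \<Longrightarrow> dist (u x) L < 1"
    using L[THEN tendstoD, of 1] by (auto simp: eventually_at_infinity)
  have "bounded (u ` cball 0 R)"
    by (intro compact_imp_bounded compact_continuous_image continuous_on_subset[OF c]) auto
  then obtain B where B: "\<forall>x\<in>cball 0 R. \<bar>u x\<bar> \<le> B"
    unfolding bounded_iff by auto
  have "\<bar>u x\<bar> \<le> max B (\<bar>L\<bar> + 1)" for x
    using B R[of x] by (cases "norm x \<le> R") (force simp: dist_real_def)+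
  then show ?thesis by blast
qed

text \<open>A weighted mean over the ball of radius \<open>R\<close> about \<open>x\<close>, left
  unnormalised: the weight, which is the rescaled profile of the bump in \<open>sum_newton2\<close>,
  has total mass 8 pi / 15.\<close>

definition avg :: "(real^3 \<Rightarrow> real) \<Rightarrow> real^3 \<Rightarrow> real \<Rightarrow> real" where
  "avg u x R = (LINT z|lborel. u (x + R *\<^sub>R z) * max 0 (1 - z \<bullet> z))"

text \<open>Substitute y = x + R z: the Jacobian R^3 cancels the factor 1 / R^3 of the bump.\<close>

lemma integral_sum_newton2:
  assumes u: "continuous_on UNIV u" and R: "R > 0"
  shows "integrable lborel (\<lambda>y. u y * (\<Sum>i\<in>UNIV. newton2 R i (y - x)))"
    and "(LINT y|lborel. u y * (\<Sum>i\<in>UNIV. newton2 R i (y - x))) = - 15 / 2 * avg u x R"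
proof -
  define f where "f y = u y * (- 15 / 2 * max 0 (1 - ((y - x) \<bullet> (y - x)) / R\<^sup>2) / R ^ 3)" for y
  have feq: "f = (\<lambda>y. u y * (\<Sum>i\<in>UNIV. newton2 R i (y - x)))"
    by (simp add: fun_eq_iff f_def sum_newton2)
  have cf: "continuous_on UNIV f"
    unfolding f_def[abs_def] divide_inverse by (intro continuous_intros u)
  have "f y = 0" if "norm y > norm x + R" for y
  proof -
    have "norm (y - x) > R" using that norm_triangle_ineq2[of y x] by simp
    then have "R\<^sup>2 < norm (y - x) ^ 2" using R by (intro power_strict_mono) auto
    then have "(y - x) \<bullet> (y - x) / R\<^sup>2 > 1" using R by (simp add: power2_norm_eq_inner)
    then show ?thesis by (simp add: f_def)
  qed
  with cf have "integrable lborel f" by (rule integrable_compact_support)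
  then show "integrable lborel (\<lambda>y. u y * (\<Sum>i\<in>UNIV. newton2 R i (y - x)))"
    by (simp only: feq)
  have "f (x + R *\<^sub>R z) = u (x + R *\<^sub>R z) * max 0 (1 - z \<bullet> z) * (- 15 / 2 / R ^ 3)" for z
    using R by (simp add: f_def power2_eq_square)
  then have "(LINT z|lborel. f (x + R *\<^sub>R z)) = avg u x R * (- 15 / 2 / R ^ 3)"
    by (simp add: avg_def)
  then have "integral\<^sup>L lborel f = - 15 / 2 * avg u x R"
    using lborel_integral_affine[OF borel_measurable_continuous_onI[OF cf] R, of x] R by simp
  then show "(LINT y|lborel. u y * (\<Sum>i\<in>UNIV. newton2 R i (y - x))) = - 15 / 2 * avg u x R"
    by (simp only: feq)
qed

text \<open>Dominated convergence, applied both to radii tending to 0 and to radii tending to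
  infinity. In the second case x + R z escapes to infinity only for z \<noteq> 0, so the hypothesis
  leaves out this null set.\<close>

lemma tendsto_avg:
  assumes c: "continuous_on UNIV u" and B: "\<And>x. \<bar>u x\<bar> \<le> B"
    and lim: "\<And>z. z \<noteq> 0 \<Longrightarrow> (\<lambda>n. u (x + R n *\<^sub>R z)) \<longlonglongrightarrow> l"
  shows "(\<lambda>n. avg u x (R n)) \<longlonglongrightarrow> l * (8 * pi / 15)"
proof -
  note w = integral_one_minus_norm_sq[THEN has_bochner_integral_integral_eq]
    integral_one_minus_norm_sq[THEN integrable.intros]
  have "(\<lambda>n. avg u x (R n)) \<longlonglongrightarrow> (LINT z|lborel. l * max 0 (1 - (z::real^3) \<bullet> z))"
    unfolding avg_def
  proof (rule integral_dominated_convergence)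
    show "(\<lambda>z::real^3. l * max 0 (1 - z \<bullet> z)) \<in> borel_measurable lborel"
      by measurable
    have "continuous_on UNIV (\<lambda>z. u (x + R n *\<^sub>R z))" for n
      by (rule continuous_on_compose2[OF c]) (auto intro!: continuous_intros)
    then have "continuous_on UNIV (\<lambda>z. u (x + R n *\<^sub>R z) * max 0 (1 - z \<bullet> z))" for n
      by (intro continuous_intros)
    then show "(\<lambda>z. u (x + R n *\<^sub>R z) * max 0 (1 - z \<bullet> z)) \<in> borel_measurable lborel" for n
      by (simp add: borel_measurable_continuous_onI)
    show "integrable lborel (\<lambda>z::real^3. B * max 0 (1 - z \<bullet> z))"
      using w(2) by (rule integrable_mult_right)
    show "AE z in lborel. (\<lambda>n. u (x + R n *\<^sub>R z) * max 0 (1 - z \<bullet> z)) \<longlonglongrightarrow> l * max 0 (1 - z \<bullet> z)"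
      using AE_lborel_singleton[of "0::real^3"] by eventually_elim (intro tendsto_intros lim)
    show "AE z in lborel. norm (u (x + R n *\<^sub>R z) * max 0 (1 - z \<bullet> z)) \<le> B * max 0 (1 - z \<bullet> z)" for n
      by (intro AE_I2) (simp add: abs_mult B mult_right_mono)
  qed
  then show ?thesis using w(1) by simp
qed

text \<open>Green's identity needs a compactly supported test function, and only the difference of
  two kernels is one. The two bumps then yield the two averages.\<close>

lemma newton_difference_integral:
  assumes u: "smooth u" and r: "0 < r" "r \<le> R"
  shows "(LINT y|lborel. (newton r (y - x) - newton R (y - x)) * laplacian u y) = - 15 / 2 * (avg u x r - avg u x R)"
proof -
  have sh: "y + t *\<^sub>R axis i 1 - x = (y - x) + t *\<^sub>R axis i 1" for y t i by simp
  have cs: "continuous_on UNIV (\<lambda>y. f (y - x))" if "continuous_on UNIV f" for f :: "real^3 \<Rightarrow> real"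
    by (rule continuous_on_compose2[OF that]) (auto intro!: continuous_intros)
  have out: "norm (y - x) > R" "norm (y - x) > r" if "norm y > norm x + R" for y
    using that norm_triangle_ineq2[of y x] r by auto
  have "(LINT y|lborel. (newton r (y - x) - newton R (y - x)) * laplacian u y) =
    (LINT y|lborel. u y * (\<Sum>i\<in>UNIV. newton2 r i (y - x) - newton2 R i (y - x)))"
  proof (rule green_identity[OF u, where R = "norm x + R"])
    fix i y
    show "((\<lambda>t. newton r (y + t *\<^sub>R axis i 1 - x) - newton R (y + t *\<^sub>R axis i 1 - x)) has_real_derivative
        newton1 r i (y - x) - newton1 R i (y - x)) (at 0)"
      unfolding sh by (intro DERIV_diff newton_deriv)
    show "((\<lambda>t. newton1 r i (y + t *\<^sub>R axis i 1 - x) - newton1 R i (y + t *\<^sub>R axis i 1 - x)) has_real_derivative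
        newton2 r i (y - x) - newton2 R i (y - x)) (at 0)"
      unfolding sh by (intro DERIV_diff newton1_deriv)
  next
    fix i and y :: "real^3" assume "norm y > norm x + R"
    note o = out[OF this]
    show "newton r (y - x) - newton R (y - x) = 0" "newton1 r i (y - x) - newton1 R i (y - x) = 0"
      "newton2 r i (y - x) - newton2 R i (y - x) = 0"
      using newton_outside[OF r(1) o(2)] newton_outside[of R, OF _ o(1)] r by auto
  qed (intro continuous_on_diff cs continuous_newton)+
  also have "\<dots> = (LINT y|lborel. u y * (\<Sum>i\<in>UNIV. newton2 r i (y - x)) - u y * (\<Sum>i\<in>UNIV. newton2 R i (y - x)))"
    by (simp add: sum_subtractf right_diff_distrib)
  also have "\<dots> = - 15 / 2 * avg u x r - (- 15 / 2 * avg u x R)"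
    using r by (subst Bochner_Integration.integral_diff)
      (simp_all only: integral_sum_newton2[OF smooth_continuous[OF u]] order_less_le_trans)
  finally show ?thesis by (simp only: right_diff_distrib)
qed

text \<open>Green's formula against \<open>newton r - newton R\<close>, in the limit \<open>r \<rightarrow> 0\<close>, \<open>R \<rightarrow> \<infinity>\<close>.\<close>

lemma newtonian_representation:
  assumes u: "smooth u" "(u \<longlongrightarrow> L) at_infinity"
    and supp: "\<And>y. norm y > R0 \<Longrightarrow> laplacian u y = 0" and x: "norm x > R0"
  shows "4 * pi * (L - u x) = (LINT y|lborel. laplacian u y / norm (x - y))"
proof -
  note cu = smooth_continuous[OF u(1)]
  obtain B where B: "\<And>x. \<bar>u x\<bar> \<le> B" using bounded_if_tendsto_at_infinity[OF cu u(2)] by blast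
  \<comment> \<open>The distance from \<open>x\<close> to the ball carrying the source. Radii
    \<open>r n\<close> below \<delta> leave the kernel exact on the source, and \<open>R n\<close>
    at least \<delta> ensures \<open>r n \<le> R n\<close>.\<close>
  define \<delta> where "\<delta> = norm x - R0"
  define r where "r n = \<delta> / (2 + real n)" for n :: nat
  define R where "R n = \<delta> * (1 + real n)" for n :: nat
  have \<delta>: "\<delta> > 0" using x by (simp add: \<delta>_def)
  have r: "0 < r n" "r n < \<delta>" and R: "\<delta> \<le> R n" "r n \<le> R n" for n
  proof -
    show "0 < r n" "r n < \<delta>" "\<delta> \<le> R n" using \<delta> by (simp_all add: r_def R_def field_simps add_pos_nonneg)
    then show "r n \<le> R n" by linarith
  qed
  have "r \<longlonglongrightarrow> 0"
    unfolding r_def[abs_def]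
    by (intro tendsto_divide_0[OF tendsto_const] filterlim_at_top_imp_at_infinity
        filterlim_tendsto_add_at_top[OF tendsto_const filterlim_real_sequentially])
  have Rtop: "filterlim R at_top sequentially"
    unfolding R_def[abs_def]
    by (intro filterlim_tendsto_pos_mult_at_top[OF tendsto_const \<delta>])
      (intro filterlim_tendsto_add_at_top[OF tendsto_const filterlim_real_sequentially])
  have "(\<lambda>n. avg u x (r n)) \<longlonglongrightarrow> u x * (8 * pi / 15)"
  proof (rule tendsto_avg[OF cu B])
    fix z
    have "(\<lambda>n. x + r n *\<^sub>R z) \<longlonglongrightarrow> x + 0 *\<^sub>R z"
      by (intro tendsto_intros \<open>r \<longlonglongrightarrow> 0\<close>)
    then show "(\<lambda>n. u (x + r n *\<^sub>R z)) \<longlonglongrightarrow> u x"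
      by (intro continuous_on_tendsto_compose[OF cu]) auto
  qed
  moreover have "(\<lambda>n. avg u x (R n)) \<longlonglongrightarrow> L * (8 * pi / 15)"
  proof (rule tendsto_avg[OF cu B])
    fix z :: "real^3" assume z: "z \<noteq> 0"
    have "filterlim (\<lambda>n. - norm x + R n * norm z) at_top sequentially"
      using z by (intro filterlim_tendsto_add_at_top[OF tendsto_const]
          filterlim_at_top_mult_tendsto_pos[OF tendsto_const _ Rtop]) auto
    moreover have "\<forall>n. - norm x + R n * norm z \<le> norm (x + R n *\<^sub>R z)"
    proof
      show "- norm x + R n * norm z \<le> norm (x + R n *\<^sub>R z)" for n
        using norm_triangle_ineq2[of "R n *\<^sub>R z" "- x"] R(1)[of n] \<delta> by (simp add: add.commute)
    qed
    ultimately have "filterlim (\<lambda>n. norm (x + R n *\<^sub>R z)) at_top sequentially"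
      by (rule filterlim_at_top_mono[OF _ always_eventually])
    then have "filterlim (\<lambda>n. x + R n *\<^sub>R z) at_infinity sequentially"
      by (simp add: filterlim_at_infinity_conv_norm_at_top)
    from filterlim_compose[OF u(2) this] show "(\<lambda>n. u (x + R n *\<^sub>R z)) \<longlonglongrightarrow> L" .
  qed
  ultimately have "(\<lambda>n. - 15 / 2 * (avg u x (r n) - avg u x (R n))) \<longlonglongrightarrow>
      - 15 / 2 * (u x * (8 * pi / 15) - L * (8 * pi / 15))"
    by (intro tendsto_intros)
  then have 1: "(\<lambda>n. LINT y|lborel. (newton (r n) (y - x) - newton (R n) (y - x)) * laplacian u y)
      \<longlonglongrightarrow> 4 * pi * (L - u x)"
    unfolding newton_difference_integral[OF u(1) r(1) R(2)] by (simp add: algebra_simps)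
  have far: "\<delta> \<le> norm (y - x)" if "laplacian u y \<noteq> 0" for y
    using that supp[of y] norm_triangle_ineq3[of y x] by (force simp: \<delta>_def)
  \<comment> \<open>On the source the inner kernel is 1 / |x - y| for every \<open>n\<close>; only
    the outer kernel changes with \<open>n\<close>, and it tends to 0.\<close>
  have near: "newton (r n) (y - x) = 1 / norm (x - y)" if "laplacian u y \<noteq> 0" for n y
    using newton_outside(1)[OF r(1) less_le_trans[OF r(2) far[OF that]]] by (simp add: norm_minus_commute)
  have bd: "0 \<le> newton (R n) z" "newton (R n) z \<le> 15 / 8 / R n" for n z
    using newton_nonneg[of "R n" z] newton_le[of "R n" z] R(1)[of n] \<delta> by auto
  have Rlim: "(\<lambda>n. newton (R n) z) \<longlonglongrightarrow> 0" for z
  proof (rule tendsto_sandwich[where f = "\<lambda>_. 0" and h = "\<lambda>n. 15 / 8 / R n"])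
    show "(\<lambda>n. 15 / 8 / R n) \<longlonglongrightarrow> 0"
      by (intro tendsto_divide_0[OF tendsto_const] filterlim_at_top_imp_at_infinity Rtop)
  qed (use bd in auto)
  have clap: "continuous_on UNIV (laplacian u)" by (rule continuous_laplacian[OF u(1)])
  have ilap: "integrable lborel (laplacian u)"
    using clap supp by (rule integrable_compact_support)
  have mlap: "laplacian u \<in> borel_measurable borel"
    by (rule borel_measurable_continuous_onI[OF clap])
  have 2: "(\<lambda>n. LINT y|lborel. (newton (r n) (y - x) - newton (R n) (y - x)) * laplacian u y)
      \<longlonglongrightarrow> (LINT y|lborel. laplacian u y / norm (x - y))"
  proof (rule integral_dominated_convergence)
    show "(\<lambda>y. laplacian u y / norm (x - y)) \<in> borel_measurable lborel"
      using mlap by measurable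
    have "continuous_on UNIV (\<lambda>y. newton S (y - x))" for S
      by (rule continuous_on_compose2[OF continuous_newton(1)]) (auto intro!: continuous_intros)
    then have "continuous_on UNIV (\<lambda>y. (newton (r n) (y - x) - newton (R n) (y - x)) * laplacian u y)" for n
      by (intro continuous_intros clap)
    then show "(\<lambda>y. (newton (r n) (y - x) - newton (R n) (y - x)) * laplacian u y) \<in> borel_measurable lborel" for n
      by (simp add: borel_measurable_continuous_onI)
    \<comment> \<open>On the source the two kernels are at most 1 / \<delta> and 15/8 / \<delta>,
      together less than 3 / \<delta>.\<close>
    show "integrable lborel (\<lambda>y. 3 / \<delta> * \<bar>laplacian u y\<bar>)"
      using ilap by (intro integrable_mult_right integrable_abs)
    show "AE y in lborel. (\<lambda>n. (newton (r n) (y - x) - newton (R n) (y - x)) * laplacian u y)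
        \<longlonglongrightarrow> laplacian u y / norm (x - y)"
    proof (rule AE_I2)
      fix y
      show "(\<lambda>n. (newton (r n) (y - x) - newton (R n) (y - x)) * laplacian u y) \<longlonglongrightarrow> laplacian u y / norm (x - y)"
      proof (cases "laplacian u y = 0")
        case False
        have "(\<lambda>n. (1 / norm (x - y) - newton (R n) (y - x)) * laplacian u y) \<longlonglongrightarrow>
            (1 / norm (x - y) - 0) * laplacian u y"
          by (intro tendsto_intros Rlim)
        then show ?thesis using near[OF False] by simp
      qed simp
    qed
    show "AE y in lborel. norm ((newton (r n) (y - x) - newton (R n) (y - x)) * laplacian u y)
        \<le> 3 / \<delta> * \<bar>laplacian u y\<bar>" for n
    proof (rule AE_I2)
      fix y
      show "norm ((newton (r n) (y - x) - newton (R n) (y - x)) * laplacian u y) \<le> 3 / \<delta> * \<bar>laplacian u y\<bar>"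
      proof (cases "laplacian u y = 0")
        case False
        have "0 \<le> 1 / norm (x - y)" "1 / norm (x - y) \<le> 1 / \<delta>"
          using far[OF False] \<delta> by (auto simp: norm_minus_commute intro!: divide_left_mono mult_pos_pos)
        moreover have "15 / 8 / R n \<le> 15 / 8 / \<delta>"
          using R(1)[of n] \<delta> by (intro divide_left_mono mult_pos_pos) auto
        moreover have "15 / 8 / \<delta> + 1 / \<delta> \<le> 3 / \<delta>" "0 < 1 / \<delta>"
          using \<delta> by (simp_all add: divide_simps)
        ultimately have "\<bar>1 / norm (x - y) - newton (R n) (y - x)\<bar> \<le> 3 / \<delta>"
          using bd[of n "y - x"] by linarith
        then show ?thesis
          unfolding near[OF False] real_norm_def abs_mult by (rule mult_right_mono) simp
      qed simp
    qed
  qed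
  show ?thesis by (rule LIMSEQ_unique[OF 1 2])
qed

section \<open>Derivatives of potentials\<close>

text \<open>The algebra generated by the coordinates and \<open>1 / |x|\<close>; away from the origin it contains
  all partial derivatives of \<open>1 / |x|\<close>.\<close>

inductive newton_algebra :: "(real^3 \<Rightarrow> real) \<Rightarrow> bool" where
  const: "newton_algebra (\<lambda>x. c)"
| coord: "newton_algebra (\<lambda>x. x $ i)"
| inv_norm: "newton_algebra (\<lambda>x. 1 / norm x)"
| add: "newton_algebra f \<Longrightarrow> newton_algebra g \<Longrightarrow> newton_algebra (\<lambda>x. f x + g x)"
| mult: "newton_algebra f \<Longrightarrow> newton_algebra g \<Longrightarrow> newton_algebra (\<lambda>x. f x * g x)"

lemma newton_algebra_continuous: "newton_algebra f \<Longrightarrow> continuous_on (- {0}) f"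
  by (induction rule: newton_algebra.induct) (auto intro!: continuous_intros)

text \<open>Product rule and the derivative of 1 / |x|. The derivative is given as a member of the
  algebra, not as \<open>partial_deriv i f\<close>, so that the step can be iterated without any
  claim at the origin.\<close>

lemma newton_algebra_partial:
  "newton_algebra f \<Longrightarrow> \<exists>f'. newton_algebra f' \<and>
    (\<forall>x. x \<noteq> 0 \<longrightarrow> ((\<lambda>t. f (x + t *\<^sub>R axis i 1)) has_real_derivative f' x) (at 0))"
proof (induction rule: newton_algebra.induct)
  case (const c)
  show ?case by (rule exI[of _ "\<lambda>_. 0"]) (auto intro: newton_algebra.const)
next
  case (coord j)
  have "((\<lambda>t. x $ j + t * (axis i 1 :: real^3) $ j) has_real_derivative (axis i 1 :: real^3) $ j) (at 0)" for x :: "real^3"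
    by (auto intro!: derivative_eq_intros)
  then show ?case
    by (intro exI[of _ "\<lambda>_. (axis i 1 :: real^3) $ j"]) (auto intro: newton_algebra.const)
next
  case inv_norm
  \<comment> \<open>This is - x_i / |x|^3 spelled out in the generators.\<close>
  let ?f = "\<lambda>x::real^3. ((- 1) * x $ i) * (1 / norm x * (1 / norm x * (1 / norm x)))"
  have "newton_algebra ?f"
    by (intro newton_algebra.intros)
  moreover have "((\<lambda>t. 1 / norm (x + t *\<^sub>R axis i 1)) has_real_derivative ?f x) (at 0)" if "x \<noteq> 0" for x
  proof -
    have q: "((\<lambda>t. x \<bullet> x + 2 * t * (x $ i) + t * t) has_real_derivative 2 * x $ i) (at 0)"
      by (auto intro!: derivative_eq_intros)
    have "(\<lambda>t. 1 / norm (x + t *\<^sub>R axis i 1)) = (\<lambda>t. inverse (sqrt (x \<bullet> x + 2 * t * (x $ i) + t * t)))"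
      by (simp add: norm_eq_sqrt_inner inner_line inverse_eq_divide)
    moreover have "((\<lambda>t. inverse (sqrt (x \<bullet> x + 2 * t * (x $ i) + t * t))) has_real_derivative ?f x) (at 0)"
    proof (rule DERIV_cong[OF DERIV_inverse_fun[OF DERIV_chain2[OF DERIV_real_sqrt q]]])
      show "0 < x \<bullet> x + 2 * 0 * (x $ i) + 0 * 0" "sqrt (x \<bullet> x + 2 * 0 * x $ i + 0 * 0) \<noteq> 0"
        using that by auto
      show "- (inverse (sqrt (x \<bullet> x + 2 * 0 * x $ i + 0 * 0)) / 2 * (2 * x $ i) *
          inverse ((sqrt (x \<bullet> x + 2 * 0 * x $ i + 0 * 0)) ^ Suc (Suc 0))) = ?f x"
        using that by (simp add: norm_eq_sqrt_inner[symmetric] field_simps)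
    qed
    ultimately show ?thesis by simp
  qed
  ultimately show ?case by blast
next
  case (add f g)
  then obtain f' g' where fg: "newton_algebra f'" "newton_algebra g'"
    "\<And>x. x \<noteq> 0 \<Longrightarrow> ((\<lambda>t. f (x + t *\<^sub>R axis i 1)) has_real_derivative f' x) (at 0)"
    "\<And>x. x \<noteq> 0 \<Longrightarrow> ((\<lambda>t. g (x + t *\<^sub>R axis i 1)) has_real_derivative g' x) (at 0)"
    by blast
  have "newton_algebra (\<lambda>x. f' x + g' x)"
    by (intro newton_algebra.intros fg)
  then show ?case
    by (intro exI[of _ "\<lambda>x. f' x + g' x"] conjI) (auto intro!: DERIV_add fg)
next
  case (mult f g)
  then obtain f' g' where fg: "newton_algebra f'" "newton_algebra g'"
    "\<And>x. x \<noteq> 0 \<Longrightarrow> ((\<lambda>t. f (x + t *\<^sub>R axis i 1)) has_real_derivative f' x) (at 0)"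
    "\<And>x. x \<noteq> 0 \<Longrightarrow> ((\<lambda>t. g (x + t *\<^sub>R axis i 1)) has_real_derivative g' x) (at 0)"
    by blast
  have "newton_algebra (\<lambda>x. f' x * g x + g' x * f x)"
    by (intro newton_algebra.intros fg mult)
  then show ?case
    by (intro exI[of _ "\<lambda>x. f' x * g x + g' x * f x"] conjI) (use DERIV_mult[OF fg(3,4)] in auto)
qed

text \<open>\<open>g\<close> stands for 1 / |x| or one of its derivatives. The scale sits in the
  kernel rather than in the density, so one fixed box supports all densities, and
  \<open>d = 0\<close> puts the whole source at the origin.\<close>

definition potential :: "(real^3 \<Rightarrow> real) \<Rightarrow> real \<Rightarrow> (real^3 \<Rightarrow> real) \<Rightarrow> real^3 \<Rightarrow> real" where
  "potential \<rho> d g x = (LINT y|lborel. \<rho> y * g (x - d *\<^sub>R y))"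

text \<open>For |y| \<le> R the point d y has norm at most d R < |x|, so the argument of
  \<open>g\<close> stays away from the singularity.\<close>

lemma potential_integrable:
  fixes \<rho> g :: "real^3 \<Rightarrow> real"
  assumes \<rho>: "continuous_on UNIV \<rho>" "\<And>y. \<rho> y \<noteq> 0 \<Longrightarrow> norm y \<le> R"
    and g: "continuous_on (- {0}) g" and d: "0 \<le> d" and x: "norm x > d * R"
  shows "integrable lborel (\<lambda>y. \<rho> y * g (x - d *\<^sub>R y))"
proof -
  have img: "(\<lambda>y. x - d *\<^sub>R y) ` cball 0 R \<subseteq> - {0}"
  proof (clarsimp)
    fix y assume "norm y \<le> R" "x = d *\<^sub>R y"
    then show False using x d mult_left_mono[of "norm y" R d] by simp
  qed
  have "continuous_on (cball 0 R) (\<lambda>y. g (x - d *\<^sub>R y))"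
    by (rule continuous_on_compose2[OF g _ img]) (intro continuous_intros)
  then have "continuous_on (cball 0 R) (\<lambda>y. \<rho> y * g (x - d *\<^sub>R y))"
    by (intro continuous_on_mult continuous_on_subset[OF \<rho>(1)]) auto
  then have "integrable lborel (\<lambda>y. indicator (cball 0 R) y *\<^sub>R (\<rho> y * g (x - d *\<^sub>R y)))"
    by (intro borel_integrable_compact) auto
  moreover have "indicator (cball 0 R) y *\<^sub>R (\<rho> y * g (x - d *\<^sub>R y)) = \<rho> y * g (x - d *\<^sub>R y)" for y
    using \<rho>(2)[of y] by (auto simp: indicator_def)
  ultimately show ?thesis by (simp only:)
qed

text \<open>Differentiation under the integral sign. The box is the domain for the Leibniz rule; the
  enclosing ball keeps the kernel away from its singularity.\<close>

lemma potential_deriv: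
  assumes \<rho>: "continuous_on UNIV \<rho>" "\<And>y. \<rho> y \<noteq> 0 \<Longrightarrow> y \<in> cbox a b" "cbox a b \<subseteq> cball 0 R"
    and g: "continuous_on (- {0}) g" "continuous_on (- {0}) g'"
    and deriv: "\<And>x. x \<noteq> 0 \<Longrightarrow> ((\<lambda>t. g (x + t *\<^sub>R axis i 1)) has_real_derivative g' x) (at 0)"
    and d: "0 \<le> d" and x: "norm x > d * R"
  shows "((\<lambda>t. potential \<rho> d g (x + t *\<^sub>R axis i 1)) has_real_derivative potential \<rho> d g' x) (at 0)"
proof -
  define e where "e = (axis i 1 :: real^3)"
  have e: "norm e = 1" by (simp add: e_def norm_axis_1)
  \<comment> \<open>Displacements |t| < |x| - d R keep \<open>x + t *\<^sub>R e\<close> outside the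
    ball of radius d R.\<close>
  define U where "U = {- (norm x - d * R) <..< norm x - d * R}"
  have U: "norm (x + t *\<^sub>R e) > d * R" if "t \<in> U" for t
    using that norm_triangle_ineq2[of x "- (t *\<^sub>R e)"] e by (auto simp: U_def abs_less_iff)
  have U0: "0 \<in> U" using x by (simp add: U_def)
  have nz: "x + t *\<^sub>R e - d *\<^sub>R y \<noteq> 0" if "t \<in> U" "y \<in> cbox a b" for t y
  proof
    assume "x + t *\<^sub>R e - d *\<^sub>R y = 0"
    then have "norm (x + t *\<^sub>R e) = d * norm y" using d by simp
    also have "\<dots> \<le> d * R" using \<rho>(3) that d by (intro mult_left_mono) auto
    finally show False using U[OF that(1)] by simp
  qed
  have int: "((\<lambda>y. \<rho> y * h (x + t *\<^sub>R e - d *\<^sub>R y)) has_integral potential \<rho> d h (x + t *\<^sub>R e)) (cbox a b)"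
    if "continuous_on (- {0}) h" "t \<in> U" for h t
    unfolding potential_def
  proof (rule has_integral_superset_support)
    show "integrable lborel (\<lambda>y. \<rho> y * h (x + t *\<^sub>R e - d *\<^sub>R y))"
      by (rule potential_integrable[OF \<rho>(1) _ that(1) d U[OF that(2)]])
        (use \<rho>(2,3) in \<open>force simp: subset_iff\<close>)
  qed (use \<rho>(2) in auto)
  have "((\<lambda>t. integral (cbox a b) (\<lambda>y. \<rho> y * g (x + t *\<^sub>R e - d *\<^sub>R y))) has_real_derivative
      integral (cbox a b) (\<lambda>y. \<rho> y * g' (x + 0 *\<^sub>R e - d *\<^sub>R y))) (at 0 within U)"
  proof (rule leibniz_rule_field_derivative)
    fix t y assume ty: "t \<in> U" "y \<in> cbox a b"
    have "((\<lambda>s. g ((x - d *\<^sub>R y) + s *\<^sub>R axis i 1)) has_real_derivative g' ((x - d *\<^sub>R y) + t *\<^sub>R axis i 1)) (at t)"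
      using nz[OF ty] by (intro line_deriv_shift[OF deriv]) (simp add: e_def algebra_simps)
    then have "((\<lambda>s. g (x + s *\<^sub>R e - d *\<^sub>R y)) has_real_derivative g' (x + t *\<^sub>R e - d *\<^sub>R y)) (at t)"
      by (simp add: e_def algebra_simps)
    then show "((\<lambda>s. \<rho> y * g (x + s *\<^sub>R e - d *\<^sub>R y)) has_real_derivative \<rho> y * g' (x + t *\<^sub>R e - d *\<^sub>R y)) (at t within U)"
      by (intro has_field_derivative_at_within[OF DERIV_cmult])
  next
    show "continuous_on (U \<times> cbox a b) (\<lambda>(t, y). \<rho> y * g' (x + t *\<^sub>R e - d *\<^sub>R y))"
      unfolding case_prod_unfold
      by (intro continuous_intros continuous_on_compose2[OF \<rho>(1)] continuous_on_compose2[OF g(2)])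
        (use nz in auto)
    show "convex U" by (simp add: U_def)
  qed (use int[OF g(1)] U0 in \<open>blast intro: has_integral_integrable\<close>)+
  then have "((\<lambda>t. integral (cbox a b) (\<lambda>y. \<rho> y * g (x + t *\<^sub>R e - d *\<^sub>R y))) has_real_derivative
      potential \<rho> d g' x) (at 0)"
    using U0 integral_unique[OF int[OF g(2) U0]] at_within_open[OF U0] by (simp add: U_def)
  then show ?thesis
    by (rule has_field_derivative_transform_within_open[where S = U])
      (use U0 integral_unique[OF int[OF g(1)]] in \<open>auto simp: U_def e_def\<close>)
qed

text \<open>The same \<open>p\<close> and \<open>g\<close> serve all densities \<open>\<rho>\<close> and scales \<open>d \<ge> 0\<close>; the Schwarzschild potential
  is the case \<open>d = 0\<close>.\<close>

lemma iterated_partial_potential: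
  fixes a b :: "real^3"
  assumes ab: "cbox a b \<subseteq> cball 0 R" and g: "newton_algebra g"
  shows "\<exists>p' g'. newton_algebra g' \<and> (\<forall>d \<rho> f. 0 \<le> d \<longrightarrow> continuous_on UNIV \<rho> \<longrightarrow>
      (\<forall>y. \<rho> y \<noteq> 0 \<longrightarrow> y \<in> cbox a b) \<longrightarrow>
      (\<forall>x. norm x > d * R \<longrightarrow> f x = p + k * potential \<rho> d g x) \<longrightarrow>
      (\<forall>x. norm x > d * R \<longrightarrow> (partial_deriv i ^^ m) f x = p' + k * potential \<rho> d g' x))"
proof (induction m)
  case 0
  show ?case using g by (intro exI[of _ p] exI[of _ g]) auto
next
  case (Suc m)
  then obtain p' g' where g': "newton_algebra g'" and
    IH: "\<And>d \<rho> f x. 0 \<le> d \<Longrightarrow> continuous_on UNIV \<rho> \<Longrightarrow> (\<And>y. \<rho> y \<noteq> 0 \<Longrightarrow> y \<in> cbox a b) \<Longrightarrow>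
      (\<And>x. norm x > d * R \<Longrightarrow> f x = p + k * potential \<rho> d g x) \<Longrightarrow> norm x > d * R \<Longrightarrow>
      (partial_deriv i ^^ m) f x = p' + k * potential \<rho> d g' x"
    by blast
  obtain g'' where g'': "newton_algebra g''" and
    deriv: "\<And>x. x \<noteq> 0 \<Longrightarrow> ((\<lambda>t. g' (x + t *\<^sub>R axis i 1)) has_real_derivative g'' x) (at 0)"
    using newton_algebra_partial[OF g'] by blast
  \<comment> \<open>One more derivative kills the constant \<open>p'\<close>. The formula for the
    m-th derivative holds on a whole interval of the line through \<open>x\<close>, so it may be
    differentiated.\<close>
  have "(partial_deriv i ^^ Suc m) f x = 0 + k * potential \<rho> d g'' x"
    if A: "0 \<le> d" "continuous_on UNIV \<rho>" "\<And>y. \<rho> y \<noteq> 0 \<Longrightarrow> y \<in> cbox a b"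
      "\<And>x. norm x > d * R \<Longrightarrow> f x = p + k * potential \<rho> d g x" and x: "norm x > d * R" for d \<rho> f x
  proof -
    have "((\<lambda>t. p' + k * potential \<rho> d g' (x + t *\<^sub>R axis i 1)) has_real_derivative 0 + k * potential \<rho> d g'' x) (at 0)"
      using newton_algebra_continuous[OF g'] newton_algebra_continuous[OF g'']
      by (intro DERIV_add DERIV_const DERIV_cmult potential_deriv[OF A(2,3) ab _ _ deriv A(1) x])
    then have "((\<lambda>t. (partial_deriv i ^^ m) f (x + t *\<^sub>R axis i 1)) has_real_derivative 0 + k * potential \<rho> d g'' x) (at 0)"
    proof (rule has_field_derivative_transform_within_open[where S = "{- (norm x - d * R) <..< norm x - d * R}"])
      fix t assume "t \<in> {- (norm x - d * R) <..< norm x - d * R}"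
      then have "norm (x + t *\<^sub>R axis i 1) > d * R"
        using norm_triangle_ineq2[of x "- (t *\<^sub>R axis i 1)"] by (auto simp: norm_axis_1 abs_less_iff)
      from IH[OF A this]
      show "p' + k * potential \<rho> d g' (x + t *\<^sub>R axis i 1) = (partial_deriv i ^^ m) f (x + t *\<^sub>R axis i 1)" by simp
    qed (use x in auto)
    then show ?thesis by (simp add: partial_deriv_eqI)
  qed
  with g'' show ?case by blast
qed

lemma multi_deriv_potential:
  fixes a b :: "real^3"
  assumes ab: "cbox a b \<subseteq> cball 0 R"
  shows "\<exists>p' g'. newton_algebra g' \<and> (\<forall>d \<rho> f. 0 \<le> d \<longrightarrow> continuous_on UNIV \<rho> \<longrightarrow>
      (\<forall>y. \<rho> y \<noteq> 0 \<longrightarrow> y \<in> cbox a b) \<longrightarrow>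
      (\<forall>x. norm x > d * R \<longrightarrow> f x = p + k * potential \<rho> d (\<lambda>x. 1 / norm x) x) \<longrightarrow>
      (\<forall>x. norm x > d * R \<longrightarrow> multi_deriv \<gamma> f x = p' + k * potential \<rho> d g' x))"
proof -
  obtain p1 g1 where 1: "newton_algebra g1" "\<And>d \<rho> f. 0 \<le> d \<longrightarrow> continuous_on UNIV \<rho> \<longrightarrow>
      (\<forall>y. \<rho> y \<noteq> 0 \<longrightarrow> y \<in> cbox a b) \<longrightarrow>
      (\<forall>x. norm x > d * R \<longrightarrow> f x = p + k * potential \<rho> d (\<lambda>x. 1 / norm x) x) \<longrightarrow>
      (\<forall>x. norm x > d * R \<longrightarrow> (partial_deriv 3 ^^ (\<gamma> $ 3)) f x = p1 + k * potential \<rho> d g1 x)"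
    using iterated_partial_potential[OF ab newton_algebra.inv_norm, where p = p and k = k and i = 3 and m = "\<gamma> $ 3"] by blast
  obtain p2 g2 where 2: "newton_algebra g2" "\<And>d \<rho> f. 0 \<le> d \<longrightarrow> continuous_on UNIV \<rho> \<longrightarrow>
      (\<forall>y. \<rho> y \<noteq> 0 \<longrightarrow> y \<in> cbox a b) \<longrightarrow>
      (\<forall>x. norm x > d * R \<longrightarrow> f x = p1 + k * potential \<rho> d g1 x) \<longrightarrow>
      (\<forall>x. norm x > d * R \<longrightarrow> (partial_deriv 2 ^^ (\<gamma> $ 2)) f x = p2 + k * potential \<rho> d g2 x)"
    using iterated_partial_potential[OF ab 1(1), where p = p1 and k = k and i = 2 and m = "\<gamma> $ 2"] by blast
  obtain p3 g3 where 3: "newton_algebra g3" "\<And>d \<rho> f. 0 \<le> d \<longrightarrow> continuous_on UNIV \<rho> \<longrightarrow>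
      (\<forall>y. \<rho> y \<noteq> 0 \<longrightarrow> y \<in> cbox a b) \<longrightarrow>
      (\<forall>x. norm x > d * R \<longrightarrow> f x = p2 + k * potential \<rho> d g2 x) \<longrightarrow>
      (\<forall>x. norm x > d * R \<longrightarrow> (partial_deriv 1 ^^ (\<gamma> $ 1)) f x = p3 + k * potential \<rho> d g3 x)"
    using iterated_partial_potential[OF ab 2(1), where p = p2 and k = k and i = 1 and m = "\<gamma> $ 1"] by blast
  show ?thesis
    unfolding multi_deriv_def
  proof (intro exI[of _ p3] exI[of _ g3] conjI 3(1) allI impI)
    fix d \<rho> f and x :: "real^3"
    assume A: "0 \<le> d" "continuous_on UNIV \<rho>" "\<forall>y. \<rho> y \<noteq> 0 \<longrightarrow> y \<in> cbox a b"
      "\<forall>x. norm x > d * R \<longrightarrow> f x = p + k * potential \<rho> d (\<lambda>x. 1 / norm x) x" and x: "norm x > d * R"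
    note 1(2)[THEN mp, THEN mp, THEN mp, THEN mp, OF A]
    note 2(2)[THEN mp, THEN mp, THEN mp, THEN mp, OF A(1-3) this]
    note 3(2)[THEN mp, THEN mp, THEN mp, THEN mp, OF A(1-3) this]
    with x show "(partial_deriv 1 ^^ (\<gamma> $ 1)) ((partial_deriv 2 ^^ (\<gamma> $ 2)) ((partial_deriv 3 ^^ (\<gamma> $ 3)) f)) x =
        p3 + k * potential \<rho> d g3 x"
      by blast
  qed
qed

section \<open>Solutions of the field equation\<close>

text \<open>Compare both potentials with the mass of \<open>\<rho>n n\<close> times
  \<open>g x\<close>. Replacing g(x - d y) by \<open>g x\<close> costs little because
  \<open>g\<close> is uniformly continuous near \<open>K\<close>; replacing the mass by that of
  \<rho> costs little because \<open>g\<close> is bounded there and the masses converge. Domination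
  by \<rho> gives a common support and a common mass bound.\<close>

lemma potential_uniform_limit:
  fixes \<rho> g :: "real^3 \<Rightarrow> real" and \<rho>n :: "nat \<Rightarrow> real^3 \<Rightarrow> real"
  assumes cont: "\<And>n. continuous_on UNIV (\<rho>n n)" "continuous_on UNIV \<rho>"
    and supp: "\<And>y. \<rho> y \<noteq> 0 \<Longrightarrow> norm y \<le> R" and R: "0 < R"
    and le: "\<And>n y. 0 \<le> \<rho>n n y" "\<And>n y. \<rho>n n y \<le> \<rho> y"
    and lim: "\<And>y. (\<lambda>n. \<rho>n n y) \<longlonglongrightarrow> \<rho> y"
    and d: "\<And>n. 0 < d n" "d \<longlonglongrightarrow> 0"
    and g: "continuous_on (- {0}) g" and K: "compact K" "0 \<notin> K"
  shows "uniform_limit K (\<lambda>n. potential (\<rho>n n) (d n) g) (potential \<rho> 0 g) sequentially"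
proof (rule uniform_limitI)
  fix \<epsilon> :: real assume \<epsilon>: "\<epsilon> > 0"
  have suppn: "norm y \<le> R" if "\<rho>n n y \<noteq> 0" for n y
    using that le[of n y] supp[of y] by force
  have int: "integrable lborel \<rho>" "integrable lborel (\<rho>n n)" for n
    using supp suppn not_le by (blast intro: integrable_compact_support[OF cont(1)] integrable_compact_support[OF cont(2)])+
  define m where "m = integral\<^sup>L lborel \<rho>"
  define M where "M n = integral\<^sup>L lborel (\<rho>n n)" for n
  have M: "M \<longlonglongrightarrow> m"
    unfolding M_def[abs_def] m_def
    by (rule integral_dominated_convergence[where w = \<rho>]) (use int lim le in auto)
  have Mm: "0 \<le> M n" "M n \<le> m" for n
    unfolding M_def m_def using int le by (auto intro!: integral_mono)
  obtain e where e: "e > 0" "ball 0 e \<subseteq> - K"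
    using K open_contains_ball[of "- K"] by (auto simp: compact_imp_closed open_Compl)
  obtain b where b: "\<And>x. x \<in> K \<Longrightarrow> norm x \<le> b"
    using compact_imp_bounded[OF K(1)] by (auto simp: bounded_iff)
  have eK: "e \<le> norm x" if "x \<in> K" for x
    using e(2) that by (auto simp: subset_iff not_less[symmetric])
  \<comment> \<open>A shell containing \<open>K\<close> and all shifted points x - d y once d R < e
    / 2.\<close>
  define C where "C = cball 0 (b + e) - ball (0::real^3) (e / 2)"
  have C: "compact C" "C \<subseteq> - {0}"
    unfolding C_def using e(1) by (auto intro: compact_diff)
  have gC: "continuous_on C g" by (rule continuous_on_subset[OF g C(2)])
  have "bounded (g ` C)" by (intro compact_imp_bounded compact_continuous_image gC C)
  then obtain B where B: "B > 0" "\<And>x. x \<in> C \<Longrightarrow> \<bar>g x\<bar> \<le> B"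
    by (auto simp: bounded_pos)
  \<comment> \<open>The summand 1 keeps the denominator positive even when the mass \<open>m\<close>
    is 0.\<close>
  define \<epsilon>' where "\<epsilon>' = \<epsilon> / (2 * (m + 1))"
  have m: "m \<ge> 0" using Mm[of 0] by simp
  then have \<epsilon>': "\<epsilon>' > 0" "m * \<epsilon>' \<le> \<epsilon> / 2"
    using \<epsilon> by (auto simp: \<epsilon>'_def field_simps)
  obtain \<delta> where \<delta>: "\<delta> > 0" "\<And>x x'. x \<in> C \<Longrightarrow> x' \<in> C \<Longrightarrow> dist x' x < \<delta> \<Longrightarrow> dist (g x') (g x) < \<epsilon>'"
    using compact_uniformly_continuous[OF gC C(1)] \<epsilon>'(1) unfolding uniformly_continuous_on_def by metis
  have "eventually (\<lambda>n. d n < min \<delta> (e / 2) / R) sequentially"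
    using \<delta>(1) e(1) R by (intro order_tendstoD(2)[OF d(2)]) auto
  moreover have "eventually (\<lambda>n. dist (M n) m < \<epsilon> / (2 * B)) sequentially"
    using \<epsilon> B by (intro tendstoD[OF M]) auto
  ultimately show "eventually (\<lambda>n. \<forall>x\<in>K. dist (potential (\<rho>n n) (d n) g x) (potential \<rho> 0 g x) < \<epsilon>) sequentially"
  proof eventually_elim
    case (elim n)
    then have dR: "d n * R < \<delta>" "d n * R < e / 2" using R by (auto simp: field_simps)
    show ?case
    proof
      fix x assume x: "x \<in> K"
      have xC: "x \<in> C" using eK[OF x] b[OF x] e(1) by (auto simp: C_def)
      have xd: "norm x > d n * R" using eK[OF x] dR e(1) by linarith
      have close: "\<bar>g (x - d n *\<^sub>R y) - g x\<bar> \<le> \<epsilon>'" if "\<rho>n n y \<noteq> 0" for y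
      proof -
        have "norm (d n *\<^sub>R y) \<le> d n * R"
          using suppn[OF that] d(1)[of n] by (simp add: mult_left_mono)
        moreover from this have "norm (x - d n *\<^sub>R y) \<le> b + e" "\<not> norm (x - d n *\<^sub>R y) < e / 2"
          using eK[OF x] b[OF x] e(1) dR norm_triangle_ineq2[of x "d n *\<^sub>R y"] norm_triangle_ineq4[of x "d n *\<^sub>R y"]
          by linarith+
        ultimately have "x - d n *\<^sub>R y \<in> C" "dist (x - d n *\<^sub>R y) x < \<delta>"
          using dR(1) unfolding C_def by (simp_all only: Diff_iff mem_cball_0 mem_ball_0 dist_norm) auto
        from \<delta>(2)[OF xC this] show ?thesis by (simp add: dist_real_def)
      qed
      have i1: "integrable lborel (\<lambda>y. \<rho>n n y * g (x - d n *\<^sub>R y))"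
        using d(1)[of n] by (intro potential_integrable[OF cont(1) suppn g _ xd]) auto
      have i2: "integrable lborel (\<lambda>y. \<rho>n n y * g x)"
        using int(2) by (rule integrable_mult_left)
      have i3: "integrable lborel (\<lambda>y. \<rho>n n y * \<epsilon>')"
        using int(2) by (rule integrable_mult_left)
      have "\<bar>LINT y|lborel. \<rho>n n y * g (x - d n *\<^sub>R y) - \<rho>n n y * g x\<bar> \<le> (LINT y|lborel. \<rho>n n y * \<epsilon>')"
      proof (rule integral_abs_bound_integral[OF Bochner_Integration.integrable_diff[OF i1 i2] i3])
        fix y
        have "\<bar>\<rho>n n y * g (x - d n *\<^sub>R y) - \<rho>n n y * g x\<bar> = \<rho>n n y * \<bar>g (x - d n *\<^sub>R y) - g x\<bar>"
          using le(1)[of n y] by (simp add: right_diff_distrib[symmetric] abs_mult)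
        also have "\<dots> \<le> \<rho>n n y * \<epsilon>'"
          using le(1)[of n y] close[of y] by (cases "\<rho>n n y = 0") (auto intro: mult_left_mono)
        finally show "\<bar>\<rho>n n y * g (x - d n *\<^sub>R y) - \<rho>n n y * g x\<bar> \<le> \<rho>n n y * \<epsilon>'" .
      qed
      also have "\<dots> = M n * \<epsilon>'" using int(2) by (simp add: M_def)
      also have "\<dots> \<le> m * \<epsilon>'" using Mm \<epsilon>'(1) by (intro mult_right_mono) auto
      also have "\<dots> \<le> \<epsilon> / 2" by (rule \<epsilon>'(2))
      finally have 1: "\<bar>potential (\<rho>n n) (d n) g x - M n * g x\<bar> \<le> \<epsilon> / 2"
        using int(2) by (simp add: Bochner_Integration.integral_diff[OF i1 i2] potential_def M_def)
      have "\<bar>M n - m\<bar> * \<bar>g x\<bar> \<le> \<bar>M n - m\<bar> * B"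
        using B(2)[OF xC] by (intro mult_left_mono) auto
      also have "\<dots> < \<epsilon> / (2 * B) * B"
        using elim(2) B(1) by (intro mult_strict_right_mono) (auto simp: dist_real_def)
      also have "\<dots> = \<epsilon> / 2" using B(1) by simp
      finally have 2: "\<bar>M n * g x - m * g x\<bar> < \<epsilon> / 2"
        by (simp add: left_diff_distrib[symmetric] abs_mult)
      have 3: "potential \<rho> 0 g x = m * g x"
        using int(1) by (simp add: potential_def m_def)
      show "dist (potential (\<rho>n n) (d n) g x) (potential \<rho> 0 g x) < \<epsilon>"
        unfolding dist_real_def 3 using 1 2 by linarith
    qed
  qed
qed

lemma matter_density_supp:
  assumes "matter_density \<Phi>"
  shows "\<exists>R>0. \<forall>y. \<Phi> y \<noteq> 0 \<longrightarrow> norm y \<le> R"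
proof -
  have "bounded {x. \<Phi> x \<noteq> 0}"
    using assms bounded_subset[OF compact_imp_bounded closure_subset] by (auto simp: matter_density_def)
  then show ?thesis by (simp add: bounded_pos)
qed

section \<open>Comparison, dilation and Newtonian form of solutions\<close>

lemma is_solution_pos: "is_solution G c \<alpha> \<Phi> L u \<Longrightarrow> 0 < u x"
  by (simp add: is_solution_def)

lemma is_solution_laplacian:
  assumes "is_solution G c \<alpha> \<Phi> L u"
  shows "laplacian u x = - 4 * pi * (G / (2 * c\<^sup>2)) * (\<Phi> x / u x powr \<alpha>)"
proof -
  have "u x powr \<alpha> \<noteq> 0" using is_solution_pos[OF assms, of x] by simp
  moreover have "u x powr \<alpha> * laplacian u x = - 4 * pi * (G / (2 * c\<^sup>2)) * \<Phi> x"
    using assms by (simp add: is_solution_def)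
  ultimately show ?thesis
    by (metis mult.commute nonzero_eq_divide_eq times_divide_eq_right)
qed

text \<open>Where \<open>u\<close> exceeds \<open>v + e\<close> it also exceeds \<open>v\<close>, as
  \<open>e\<close> is nonnegative; the source divided by the larger power is then smaller, which is
  the inequality of Laplacians asked by the comparison principle.\<close>

lemma is_solution_le:
  assumes "is_solution G c \<alpha> \<Phi> a u" "is_solution G c \<alpha> \<Phi> b v"
    and "\<And>x. 0 \<le> \<Phi> x" "G > 0" "0 \<le> \<alpha>" "a \<le> b + e" "0 \<le> e"
  shows "u x \<le> v x + e"
proof (rule comparison_principle[where u = u and v = v and a = a and b = b])
  fix x assume "u x > v x + e"
  then have uv: "v x \<le> u x" using assms(7) by simp
  have v: "0 < v x" using assms(2) by (simp add: is_solution_def)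
  then have "\<Phi> x / u x powr \<alpha> \<le> \<Phi> x / v x powr \<alpha>"
    using uv assms by (intro divide_left_mono powr_mono2 mult_pos_pos) auto
  then have "4 * pi * (G / (2 * c\<^sup>2)) * (\<Phi> x / u x powr \<alpha>) \<le> 4 * pi * (G / (2 * c\<^sup>2)) * (\<Phi> x / v x powr \<alpha>)"
    using assms(4) by (intro mult_left_mono) auto
  then show "laplacian u x \<ge> laplacian v x"
    unfolding is_solution_laplacian[OF assms(1)] is_solution_laplacian[OF assms(2)] by simp
qed (use assms in \<open>auto simp: is_solution_def\<close>)

text \<open>The power of the solution contributes d^\<alpha>, and its Laplacian d^3, namely d from
  the amplitude and d^2 from the chain rule. They cancel the factors d^(-\<alpha>) and d^(-3) of the
  rescaled density.\<close>

lemma is_solution_dilate: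
  assumes d: "0 < d"
    and sol: "is_solution G c \<alpha> (\<lambda>x. d powr (- \<alpha>) * pushforward_dilation d \<Phi> x) 1 \<theta>"
  shows "is_solution G c \<alpha> \<Phi> d (\<lambda>y. d * \<theta> (d *\<^sub>R y))"
  unfolding is_solution_def
proof (intro conjI allI)
  have sm: "smooth \<theta>" using sol by (simp add: is_solution_def)
  then show "smooth (\<lambda>y. d * \<theta> (d *\<^sub>R y))" by (rule smooth_scale)
  show "0 < d * \<theta> (d *\<^sub>R y)" for y using sol d by (simp add: is_solution_def)
  show "((\<lambda>y. d * \<theta> (d *\<^sub>R y)) \<longlongrightarrow> d) at_infinity"
  proof -
    have "((\<lambda>y. \<theta> (d *\<^sub>R y)) \<longlongrightarrow> 1) at_infinity"
    proof (rule tendstoI)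
      fix e :: real assume "e > 0"
      moreover have "(\<theta> \<longlongrightarrow> 1) at_infinity" using sol by (simp add: is_solution_def)
      ultimately obtain b where b: "\<And>x. norm x \<ge> b \<Longrightarrow> dist (\<theta> x) 1 < e"
        by (auto simp: tendsto_iff eventually_at_infinity)
      have "dist (\<theta> (d *\<^sub>R y)) 1 < e" if "norm y \<ge> b / d" for y
        using that d by (intro b) (simp add: field_simps)
      then show "eventually (\<lambda>y. dist (\<theta> (d *\<^sub>R y)) 1 < e) at_infinity"
        unfolding eventually_at_infinity by blast
    qed
    from tendsto_mult[OF tendsto_const[of d] this] show ?thesis by simp
  qed
  show "(d * \<theta> (d *\<^sub>R y)) powr \<alpha> * laplacian (\<lambda>y. d * \<theta> (d *\<^sub>R y)) y = - 4 * pi * (G / (2 * c\<^sup>2)) * \<Phi> y" for y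
  proof -
    have pw: "d powr \<alpha> * d powr (- \<alpha>) = 1" "d ^ 3 * d powr (- 3) = 1"
      using d by (simp_all add: powr_minus powr_numeral)
    have "(d * \<theta> (d *\<^sub>R y)) powr \<alpha> * laplacian (\<lambda>y. d * \<theta> (d *\<^sub>R y)) y =
        d powr \<alpha> * d ^ 3 * (\<theta> (d *\<^sub>R y) powr \<alpha> * laplacian \<theta> (d *\<^sub>R y))"
      using powr_mult[of d "\<theta> (d *\<^sub>R y)" \<alpha>] d less_imp_le[OF is_solution_pos[OF sol, of "d *\<^sub>R y"]]
      unfolding laplacian_scale[OF sm] by (simp add: power2_eq_square power3_eq_cube)
    also have "\<theta> (d *\<^sub>R y) powr \<alpha> * laplacian \<theta> (d *\<^sub>R y) =
        - 4 * pi * (G / (2 * c\<^sup>2)) * (d powr (- \<alpha>) * (d powr (- 3) * \<Phi> y))"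
      using sol d by (simp add: is_solution_def pushforward_dilation_def)
    also have "d powr \<alpha> * d ^ 3 * (- 4 * pi * (G / (2 * c\<^sup>2)) * (d powr (- \<alpha>) * (d powr (- 3) * \<Phi> y))) =
        (d powr \<alpha> * d powr (- \<alpha>)) * (d ^ 3 * d powr (- 3)) * (- 4 * pi * (G / (2 * c\<^sup>2)) * \<Phi> y)"
      by (simp only: mult_ac)
    finally show ?thesis unfolding pw by simp
  qed
qed

lemma is_solution_continuous_density:
  assumes "is_solution G c \<alpha> \<Phi> L u" "smooth \<Phi>"
  shows "continuous_on UNIV (\<lambda>y. \<Phi> y / u y powr \<alpha>)"
proof -
  have "u y \<noteq> 0" for y using is_solution_pos[OF assms(1), of y] by simp
  then show ?thesis
    using smooth_continuous[of u] smooth_continuous[OF assms(2)] assms(1)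
    by (intro continuous_intros) (auto simp: is_solution_def)
qed

text \<open>The Newtonian representation at x / d, using |x / d - y| = |x - d y| / d. When
  \<open>u\<close> is the dilation of \<theta> by \<open>d\<close>, with \<open>L = d\<close>, the
  left side is \<theta>(x) and the constant is 1.\<close>

lemma is_solution_potential:
  assumes sol: "is_solution G c \<alpha> \<Phi> L u" and supp: "\<And>y. \<Phi> y \<noteq> 0 \<Longrightarrow> norm y \<le> R"
    and d: "0 < d" and x: "norm x > d * R"
  shows "u (x /\<^sub>R d) / d = L / d + G / (2 * c\<^sup>2) * potential (\<lambda>y. \<Phi> y / u y powr \<alpha>) d (\<lambda>x. 1 / norm x) x"
proof -
  let ?k = "G / (2 * c\<^sup>2)"
  have x': "norm (x /\<^sub>R d) > R" using d x by (simp add: field_simps)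
  have "4 * pi * (L - u (x /\<^sub>R d)) = (LINT y|lborel. laplacian u y / norm (x /\<^sub>R d - y))"
  proof (rule newtonian_representation[OF _ _ _ x'])
    show "laplacian u y = 0" if "norm y > R" for y
      unfolding is_solution_laplacian[OF sol] using supp[of y] that by auto
  qed (use sol in \<open>auto simp: is_solution_def\<close>)
  also have "\<dots> = (LINT y|lborel. - 4 * pi * ?k * d * (\<Phi> y / u y powr \<alpha> * (1 / norm (x - d *\<^sub>R y))))"
  proof (rule Bochner_Integration.integral_cong[OF refl])
    fix y
    have "x /\<^sub>R d - y = (x - d *\<^sub>R y) /\<^sub>R d" using d by (simp add: algebra_simps)
    then have "norm (x /\<^sub>R d - y) = norm (x - d *\<^sub>R y) / d" using d by (simp add: divide_inverse mult.commute)
    then show "laplacian u y / norm (x /\<^sub>R d - y) = - 4 * pi * ?k * d * (\<Phi> y / u y powr \<alpha> * (1 / norm (x - d *\<^sub>R y)))"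
      unfolding is_solution_laplacian[OF sol] by (simp add: mult_ac)
  qed
  also have "\<dots> = - 4 * pi * ?k * d * potential (\<lambda>y. \<Phi> y / u y powr \<alpha>) d (\<lambda>x. 1 / norm x) x"
    unfolding potential_def by (rule integral_mult_right_zero)
  finally have "4 * pi * (u (x /\<^sub>R d) - (L + ?k * d * potential (\<lambda>y. \<Phi> y / u y powr \<alpha>) d (\<lambda>x. 1 / norm x) x)) = 0"
    by (simp add: algebra_simps)
  then have "u (x /\<^sub>R d) = L + ?k * d * potential (\<lambda>y. \<Phi> y / u y powr \<alpha>) d (\<lambda>x. 1 / norm x) x"
    by simp
  then show ?thesis using d by (simp add: add_divide_distrib)
qed

lemma potential_0: "potential \<rho> 0 g x = integral\<^sup>L lborel \<rho> * g x"
  by (simp add: potential_def)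

lemma dilated_solutions_converge:
  assumes G: "G > 0" and \<Phi>: "matter_density \<Phi>" and d: "\<And>n. 0 < d n" "d \<longlonglongrightarrow> 0" and \<alpha>: "0 \<le> \<alpha>"
    and \<theta>: "\<And>n. is_solution G c \<alpha> (\<lambda>x. d n powr (- \<alpha>) * pushforward_dilation (d n) \<Phi> x) 1 (\<theta> n)"
    and \<Theta>: "is_solution G c \<alpha> \<Phi> 0 \<Theta>" and K: "compact K" "0 \<notin> K"
  shows "uniform_limit K (\<lambda>n. multi_deriv \<gamma> (\<theta> n))
           (multi_deriv \<gamma> (theta_Schw G c (effective_mass \<Phi> \<alpha> \<Theta>))) sequentially"
proof -
  define k where "k = G / (2 * c\<^sup>2)"
  have \<Phi>0: "0 \<le> \<Phi> x" and sm: "smooth \<Phi>" for x using \<Phi> by (auto simp: matter_density_def)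
  obtain R0 where R0: "0 < R0" "\<And>y. \<Phi> y \<noteq> 0 \<Longrightarrow> norm y \<le> R0" using matter_density_supp[OF \<Phi>] by blast
  \<comment> \<open>The support lies in a ball, the ball in a box for the Leibniz rule, and the box
    in a ball whose radius controls the distance to the singularity.\<close>
  obtain a :: "real^3" where a: "cball 0 R0 \<subseteq> cbox (- a) a"
    using bounded_subset_cbox_symmetric[OF bounded_cball] .
  obtain R where R: "0 < R" "cbox (- a) a \<subseteq> cball 0 R"
    using bounded_cbox[of "- a" a] unfolding bounded_pos by (auto simp: subset_iff)
  have box: "y \<in> cbox (- a) a" if "\<Phi> y \<noteq> 0" for y using R0(2)[OF that] a by auto
  have supp: "norm y \<le> R" if "\<Phi> y \<noteq> 0" for y using box[OF that] R(2) by auto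
  define U where "U n y = d n * \<theta> n (d n *\<^sub>R y)" for n y
  have U: "is_solution G c \<alpha> \<Phi> (d n) (U n)" for n
    unfolding U_def[abs_def] by (rule is_solution_dilate[OF d(1) \<theta>])
  \<comment> \<open>The limits at infinity are 0 and \<open>d n\<close>: shift 0 suffices from below
    and shift \<open>d n\<close> from above.\<close>
  have lower: "\<Theta> y \<le> U n y" for n y
    using is_solution_le[OF \<Theta> U \<Phi>0 G \<alpha>, where e = 0] d(1)[of n] by simp
  have upper: "U n y \<le> \<Theta> y + d n" for n y
    using is_solution_le[OF U \<Theta> \<Phi>0 G \<alpha>, where e = "d n"] d(1)[of n] by simp
  have \<Theta>0: "0 < \<Theta> y" for y by (rule is_solution_pos[OF \<Theta>])
  define \<rho> where "\<rho> y = \<Phi> y / \<Theta> y powr \<alpha>" for y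
  define \<rho>n where "\<rho>n n y = \<Phi> y / U n y powr \<alpha>" for n y
  have cont: "continuous_on UNIV \<rho>" "continuous_on UNIV (\<rho>n n)" for n
    unfolding \<rho>_def[abs_def] \<rho>n_def[abs_def]
    by (rule is_solution_continuous_density[OF \<Theta> sm], rule is_solution_continuous_density[OF U sm])
  have mono: "0 \<le> \<rho>n n y" "\<rho>n n y \<le> \<rho> y" for n y
  proof -
    have "0 < \<Theta> y powr \<alpha>" "\<Theta> y powr \<alpha> \<le> U n y powr \<alpha>"
      using \<Theta>0[of y] lower[of y n] \<alpha> by (auto intro: powr_mono2)
    then show "0 \<le> \<rho>n n y" "\<rho>n n y \<le> \<rho> y"
      unfolding \<rho>_def \<rho>n_def using \<Phi>0[of y] by (auto intro!: divide_left_mono mult_pos_pos)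
  qed
  have Ulim: "(\<lambda>n. U n y) \<longlonglongrightarrow> \<Theta> y" for y
  proof (rule tendsto_sandwich[where f = "\<lambda>_. \<Theta> y" and h = "\<lambda>n. \<Theta> y + d n"])
    show "(\<lambda>n. \<Theta> y + d n) \<longlonglongrightarrow> \<Theta> y"
      using tendsto_add[OF tendsto_const d(2)] by simp
  qed (use lower upper in \<open>auto intro: always_eventually\<close>)
  have \<rho>lim: "(\<lambda>n. \<rho>n n y) \<longlonglongrightarrow> \<rho> y" for y
    unfolding \<rho>_def \<rho>n_def using \<Theta>0[of y] by (intro tendsto_intros Ulim) auto
  \<comment> \<open>One pair \<open>p\<close>, \<open>g\<close> is fixed before \<open>n\<close>, so
    the approximants and the limit differ only in density and scale.\<close>
  obtain p g where g: "newton_algebra g" and rep: "\<And>d \<rho> f. 0 \<le> d \<longrightarrow> continuous_on UNIV \<rho> \<longrightarrow>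
      (\<forall>y. \<rho> y \<noteq> 0 \<longrightarrow> y \<in> cbox (- a) a) \<longrightarrow>
      (\<forall>x. norm x > d * R \<longrightarrow> f x = 1 + k * potential \<rho> d (\<lambda>x. 1 / norm x) x) \<longrightarrow>
      (\<forall>x. norm x > d * R \<longrightarrow> multi_deriv \<gamma> f x = p + k * potential \<rho> d g x)"
    using multi_deriv_potential[OF R(2), where p = 1 and k = k and \<gamma> = \<gamma>] by blast
  have \<theta>rep: "multi_deriv \<gamma> (\<theta> n) x = p + k * potential (\<rho>n n) (d n) g x" if x: "norm x > d n * R" for n x
  proof (rule rep[rule_format, OF _ cont(2) _ _ x])
    show "0 \<le> d n" using d(1)[of n] by simp
    show "y \<in> cbox (- a) a" if "\<rho>n n y \<noteq> 0" for y using that box[of y] by (auto simp: \<rho>n_def)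
    show "\<theta> n z = 1 + k * potential (\<rho>n n) (d n) (\<lambda>x. 1 / norm x) z" if "norm z > d n * R" for z
      using is_solution_potential[OF U[of n] supp d(1) that] d(1)[of n] by (simp add: U_def \<rho>n_def[abs_def] k_def)
  qed
  have Srep: "multi_deriv \<gamma> (theta_Schw G c (effective_mass \<Phi> \<alpha> \<Theta>)) x = p + k * potential \<rho> 0 g x"
    if x: "x \<noteq> 0" for x
  proof (rule rep[rule_format, OF _ cont(1)])
    show "y \<in> cbox (- a) a" if "\<rho> y \<noteq> 0" for y using that box[of y] by (auto simp: \<rho>_def)
    show "theta_Schw G c (effective_mass \<Phi> \<alpha> \<Theta>) z = 1 + k * potential \<rho> 0 (\<lambda>x. 1 / norm x) z" for z
      by (simp add: theta_Schw_def effective_mass_def potential_0 k_def \<rho>_def[abs_def])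
  qed (use x in auto)
  have "uniform_limit K (\<lambda>n. potential (\<rho>n n) (d n) g) (potential \<rho> 0 g) sequentially"
  proof (rule potential_uniform_limit[OF cont(2,1) _ R(1) mono \<rho>lim d newton_algebra_continuous[OF g] K])
    show "norm y \<le> R" if "\<rho> y \<noteq> 0" for y using that supp[of y] by (auto simp: \<rho>_def)
  qed
  then have lim: "uniform_limit K (\<lambda>n x. p + k * potential (\<rho>n n) (d n) g x) (\<lambda>x. p + k * potential \<rho> 0 g x) sequentially"
    by (intro uniform_limit_intros bounded_linear.uniform_limit[OF bounded_linear_mult_right])
  \<comment> \<open>The representation is only available for |x| > d n * R; this region contains
    \<open>K\<close> once \<open>d n\<close> is small.\<close>
  have ev: "eventually (\<lambda>n. \<forall>x\<in>K. p + k * potential (\<rho>n n) (d n) g x = multi_deriv \<gamma> (\<theta> n) x) sequentially"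
  proof -
    obtain e where e: "e > 0" "ball 0 e \<subseteq> - K"
      using K open_contains_ball[of "- K"] by (auto simp: compact_imp_closed open_Compl)
    have "eventually (\<lambda>n. d n < e / R) sequentially"
      using e R by (intro order_tendstoD(2)[OF d(2)]) auto
    then show ?thesis
    proof eventually_elim
      case (elim n)
      show ?case
      proof
        fix x assume "x \<in> K"
        then have "e \<le> norm x" using e(2) by (auto simp: subset_iff not_less[symmetric])
        moreover have "d n * R < e" using elim R by (simp add: field_simps)
        ultimately show "p + k * potential (\<rho>n n) (d n) g x = multi_deriv \<gamma> (\<theta> n) x"
          by (intro \<theta>rep[symmetric]) simp
      qed
    qed
  qed
  have eq: "p + k * potential \<rho> 0 g x = multi_deriv \<gamma> (theta_Schw G c (effective_mass \<Phi> \<alpha> \<Theta>)) x"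
    if "x \<in> K" for x
    by (rule Srep[symmetric]) (use that K(2) in auto)
  show ?thesis
    using lim uniform_limit_cong[where f = "\<lambda>n x. p + k * potential (\<rho>n n) (d n) g x"
        and g = "\<lambda>n. multi_deriv \<gamma> (\<theta> n)" and h = "\<lambda>x. p + k * potential \<rho> 0 g x", OF ev eq] by blast
qed

section \<open>Dependence of solutions and effective mass on the exponent\<close>

lemma powr_le_exp_abs_ln:
  fixes v :: real
  assumes "0 < v" "\<bar>ln v\<bar> \<le> C"
  shows "v powr \<alpha> \<le> exp (C * \<bar>\<alpha> - \<beta>\<bar>) * v powr \<beta>"
proof -
  have "(\<alpha> - \<beta>) * ln v \<le> \<bar>\<alpha> - \<beta>\<bar> * \<bar>ln v\<bar>"
    using abs_ge_self[of "(\<alpha> - \<beta>) * ln v"] by (simp only: abs_mult)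
  also have "\<dots> \<le> \<bar>\<alpha> - \<beta>\<bar> * C" using assms(2) by (intro mult_left_mono) auto
  finally have "\<alpha> * ln v \<le> C * \<bar>\<alpha> - \<beta>\<bar> + \<beta> * ln v" by (simp add: algebra_simps)
  then show ?thesis using assms(1) by (simp add: powr_def exp_add[symmetric])
qed

text \<open>Hypothesis \<open>sub\<close> says that \<open>E * v\<close> is a supersolution for
  exponent \<alpha> on the part of the source where \<open>u\<close> exceeds it. The comparison
  principle inspects only points with that excess, and off the source both Laplacians
  vanish.\<close>

lemma supersolution_compare:
  assumes u: "is_solution G c \<alpha> \<Phi> 0 u" and v: "is_solution G c \<beta> \<Phi> 0 v"
    and G: "G > 0" and \<Phi>: "\<And>x. 0 \<le> \<Phi> x" and E: "E > 0"
    and sub: "\<And>x. \<Phi> x \<noteq> 0 \<Longrightarrow> u x > E * v x \<Longrightarrow> v x powr \<beta> \<le> E * u x powr \<alpha>"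
  shows "u x \<le> E * v x"
proof -
  have smv: "smooth v" using v by (simp add: is_solution_def)
  \<comment> \<open>The trivial dilation and summand match the forms of \<open>smooth_scale\<close>,
    \<open>laplacian_scale\<close> and \<open>comparison_principle\<close>.\<close>
  have "u x \<le> E * v (1 *\<^sub>R x) + 0"
  proof (rule comparison_principle[where u = u and v = "\<lambda>x. E * v (1 *\<^sub>R x)" and a = 0 and b = "E * 0"])
    show "smooth (\<lambda>x. E * v (1 *\<^sub>R x))" by (rule smooth_scale[OF smv])
    show "((\<lambda>x. E * v (1 *\<^sub>R x)) \<longlongrightarrow> E * 0) at_infinity"
      using v by (intro tendsto_intros) (simp add: is_solution_def)
    fix x assume less: "u x > E * v (1 *\<^sub>R x) + 0"
    have lv: "laplacian (\<lambda>x. E * v (1 *\<^sub>R x)) x = E * laplacian v x"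
      using laplacian_scale[OF smv, of E 1 x] by simp
    have "\<Phi> x / u x powr \<alpha> \<le> E * (\<Phi> x / v x powr \<beta>)"
    proof (cases "\<Phi> x = 0")
      case False
      have pos: "0 < u x powr \<alpha>" "0 < v x powr \<beta>"
        using is_solution_pos[OF u, of x] is_solution_pos[OF v, of x] by simp_all
      have "v x powr \<beta> \<le> E * u x powr \<alpha>" using sub[OF False] less by simp
      then have "\<Phi> x * v x powr \<beta> \<le> \<Phi> x * (E * u x powr \<alpha>)"
        using \<Phi> by (rule mult_left_mono)
      then show ?thesis using pos by (simp add: divide_simps mult_ac)
    qed simp
    then have "4 * pi * (G / (2 * c\<^sup>2)) * (\<Phi> x / u x powr \<alpha>) \<le> 4 * pi * (G / (2 * c\<^sup>2)) * (E * (\<Phi> x / v x powr \<beta>))"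
      using G by (intro mult_left_mono) auto
    then show "laplacian (\<lambda>x. E * v (1 *\<^sub>R x)) x \<le> laplacian u x"
      unfolding lv is_solution_laplacian[OF u] is_solution_laplacian[OF v] by (simp add: mult_ac)
  qed (use u in \<open>auto simp: is_solution_def\<close>)
  then show ?thesis by simp
qed

text \<open>As \<open>|ln v| \<le> C\<close> where \<open>\<Phi> \<noteq> 0\<close>, multiplying \<open>v\<close> by \<open>E = exp (C |\<alpha> - \<beta>|)\<close> turns it into a
  supersolution of the equation with exponent \<open>\<alpha>\<close>, and dividing by \<open>E\<close> into a subsolution.\<close>

lemma solutions_close_in_exponent:
  assumes u: "is_solution G c \<alpha> \<Phi> 0 u" and v: "is_solution G c \<beta> \<Phi> 0 v"
    and G: "G > 0" and \<Phi>: "\<And>x. 0 \<le> \<Phi> x" and \<alpha>: "0 \<le> \<alpha>"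
    and C: "C \<ge> 0" "\<And>x. \<Phi> x \<noteq> 0 \<Longrightarrow> \<bar>ln (v x)\<bar> \<le> C"
  defines "E \<equiv> exp (C * \<bar>\<alpha> - \<beta>\<bar>)"
  shows "u x \<le> E * v x" and "v x \<le> E * u x"
proof -
  have E: "E \<ge> 1" using C(1) by (simp add: E_def)
  note pos = is_solution_pos[OF u] is_solution_pos[OF v]
  show "u x \<le> E * v x"
  proof (rule supersolution_compare[OF u v G \<Phi>])
    fix x assume x: "\<Phi> x \<noteq> 0" "u x > E * v x"
    \<comment> \<open>Only the logarithm of \<open>v\<close> is bounded by \<open>C\<close>. The
      exponent is therefore changed on \<open>v\<close>, and the ordering in this region carries the
      estimate to \<open>u\<close>.\<close>
    have "v x \<le> u x"
      using x(2) mult_right_mono[OF E less_imp_le[OF pos(2), of x]] by simp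
    have "v x powr \<beta> \<le> E * v x powr \<alpha>"
      using powr_le_exp_abs_ln[OF pos(2) C(2)[OF x(1)], of \<beta> \<alpha>] by (simp add: E_def abs_minus_commute)
    also have "E * v x powr \<alpha> \<le> E * u x powr \<alpha>"
      using \<open>v x \<le> u x\<close> E pos \<alpha> by (intro mult_left_mono powr_mono2) (auto intro: less_imp_le)
    finally show "v x powr \<beta> \<le> E * u x powr \<alpha>" .
  qed (use E in simp)
  show "v x \<le> E * u x"
  proof (rule supersolution_compare[OF v u G \<Phi>])
    fix x assume x: "\<Phi> x \<noteq> 0" "v x > E * u x"
    have "u x \<le> v x"
      using x(2) mult_right_mono[OF E less_imp_le[OF pos(1), of x]] by simp
    then have "u x powr \<alpha> \<le> v x powr \<alpha>"
      using pos \<alpha> by (intro powr_mono2) (auto intro: less_imp_le)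
    also have "\<dots> \<le> E * v x powr \<beta>"
      unfolding E_def by (rule powr_le_exp_abs_ln[OF pos(2) C(2)[OF x(1)]])
    finally show "u x powr \<alpha> \<le> E * v x powr \<beta>" .
  qed (use E in simp)
qed

text \<open>The factor 2 collects two errors: replacing \<open>u\<close> by \<open>v\<close> at
  exponent \<alpha> costs \<alpha> C |\<alpha> - \<beta>|, at most C |\<alpha> - \<beta>| as
  \<alpha> \<le> 1, and changing the exponent on \<open>v\<close> costs C |\<alpha> - \<beta>|. The
  pointwise bounds are then integrated.\<close>

lemma effective_mass_close:
  assumes u: "is_solution G c \<alpha> \<Phi> 0 u" and v: "is_solution G c \<beta> \<Phi> 0 v"
    and G: "G > 0" and \<Phi>: "matter_density \<Phi>" and \<alpha>: "0 \<le> \<alpha>" "\<alpha> \<le> 1"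
    and C: "C \<ge> 0" "\<And>x. \<Phi> x \<noteq> 0 \<Longrightarrow> \<bar>ln (v x)\<bar> \<le> C"
  defines "E \<equiv> exp (2 * (C * \<bar>\<alpha> - \<beta>\<bar>))"
  shows "effective_mass \<Phi> \<alpha> u \<le> E * effective_mass \<Phi> \<beta> v"
    and "effective_mass \<Phi> \<beta> v \<le> E * effective_mass \<Phi> \<alpha> u"
proof -
  have \<Phi>0: "0 \<le> \<Phi> x" and sm: "smooth \<Phi>" for x using \<Phi> by (auto simp: matter_density_def)
  obtain R0 where R0: "\<And>y. \<Phi> y \<noteq> 0 \<Longrightarrow> norm y \<le> R0" using matter_density_supp[OF \<Phi>] by blast
  note pos = is_solution_pos[OF u] is_solution_pos[OF v]
  have int: "integrable lborel (\<lambda>y. \<Phi> y / w y powr \<gamma>)" if "is_solution G c \<gamma> \<Phi> 0 w" for \<gamma> w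
    by (rule integrable_compact_support[OF is_solution_continuous_density[OF that sm], of R0])
      (use R0 in force)
  have bound: "\<Phi> x / u x powr \<alpha> \<le> E * (\<Phi> x / v x powr \<beta>)" "\<Phi> x / v x powr \<beta> \<le> E * (\<Phi> x / u x powr \<alpha>)" for x
  proof -
    have "v x powr \<beta> \<le> E * u x powr \<alpha>" "u x powr \<alpha> \<le> E * v x powr \<beta>" if x: "\<Phi> x \<noteq> 0"
    proof -
      let ?e = "C * \<bar>\<alpha> - \<beta>\<bar>"
      note close = solutions_close_in_exponent[OF u v G \<Phi>0 \<alpha>(1) C, of x]
      have ln: "ln (u x) \<le> ?e + ln (v x)" "ln (v x) \<le> ?e + ln (u x)"
        using ln_mono[OF close(1)] ln_mono[OF close(2)] pos[of x] by (simp_all add: ln_mult)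
      have e: "0 \<le> ?e" "\<alpha> * ?e \<le> ?e"
        using C(1) \<alpha> by (auto intro: mult_left_le_one_le)
      have le: "(\<beta> - \<alpha>) * ln (v x) \<le> ?e" "(\<alpha> - \<beta>) * ln (v x) \<le> ?e"
      proof -
        have "\<bar>(\<alpha> - \<beta>) * ln (v x)\<bar> \<le> \<bar>\<alpha> - \<beta>\<bar> * C"
          unfolding abs_mult using C(2)[OF x] by (intro mult_left_mono) auto
        then show "(\<beta> - \<alpha>) * ln (v x) \<le> ?e" "(\<alpha> - \<beta>) * ln (v x) \<le> ?e"
          by (auto simp: abs_le_iff algebra_simps)
      qed
      have "\<alpha> * ln (u x) \<le> \<alpha> * ?e + \<alpha> * ln (v x)" "\<alpha> * ln (v x) \<le> \<alpha> * ?e + \<alpha> * ln (u x)"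
        using mult_left_mono[OF ln(1) \<alpha>(1)] mult_left_mono[OF ln(2) \<alpha>(1)] by (simp_all add: distrib_left)
      then have "\<beta> * ln (v x) \<le> 2 * ?e + \<alpha> * ln (u x)" "\<alpha> * ln (u x) \<le> 2 * ?e + \<beta> * ln (v x)"
        using e le by (simp_all add: left_diff_distrib)
      then show "v x powr \<beta> \<le> E * u x powr \<alpha>" "u x powr \<alpha> \<le> E * v x powr \<beta>"
        using pos[of x] by (simp_all add: E_def powr_def exp_add[symmetric])
    qed
    note pw = this
    have p: "0 < u x powr \<alpha>" "0 < v x powr \<beta>" using pos[of x] by simp_all
    show "\<Phi> x / u x powr \<alpha> \<le> E * (\<Phi> x / v x powr \<beta>)"
    proof (cases "\<Phi> x = 0")
      case False
      from mult_left_mono[OF pw(1)[OF False] \<Phi>0] show ?thesis using p by (simp add: divide_simps mult_ac)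
    qed simp
    show "\<Phi> x / v x powr \<beta> \<le> E * (\<Phi> x / u x powr \<alpha>)"
    proof (cases "\<Phi> x = 0")
      case False
      from mult_left_mono[OF pw(2)[OF False] \<Phi>0] show ?thesis using p by (simp add: divide_simps mult_ac)
    qed simp
  qed
  have "effective_mass \<Phi> \<alpha> u \<le> (LINT y|lborel. E * (\<Phi> y / v y powr \<beta>))"
    unfolding effective_mass_def by (intro integral_mono int[OF u] integrable_mult_right int[OF v] bound)
  then show "effective_mass \<Phi> \<alpha> u \<le> E * effective_mass \<Phi> \<beta> v"
    unfolding effective_mass_def integral_mult_right_zero .
  have "effective_mass \<Phi> \<beta> v \<le> (LINT y|lborel. E * (\<Phi> y / u y powr \<alpha>))"
    unfolding effective_mass_def by (intro integral_mono int[OF v] integrable_mult_right int[OF u] bound)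
  then show "effective_mass \<Phi> \<beta> v \<le> E * effective_mass \<Phi> \<alpha> u"
    unfolding effective_mass_def integral_mult_right_zero .
qed

text \<open>The constant \<open>C\<close> depends only on the solution at the limit point \<beta>,
  by compactness of a ball carrying the source. So the mass at \<alpha> lies between the mass at
  \<beta> divided and multiplied by \<open>E \<alpha>\<close>, which tends to 1.\<close>

lemma effective_mass_continuous:
  assumes G: "G > 0" and \<Phi>: "matter_density \<Phi>"
    and \<Theta>: "\<And>\<alpha>. \<alpha> \<in> {0..1} \<Longrightarrow> is_solution G c \<alpha> \<Phi> 0 (\<Theta> \<alpha>)"
  shows "continuous_on {0..1} (\<lambda>\<alpha>. effective_mass \<Phi> \<alpha> (\<Theta> \<alpha>))"
  unfolding continuous_on_def
proof
  fix \<beta> :: real assume \<beta>: "\<beta> \<in> {0..1}"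
  note v = \<Theta>[OF \<beta>]
  obtain R where R: "\<And>y. \<Phi> y \<noteq> 0 \<Longrightarrow> norm y \<le> R" using matter_density_supp[OF \<Phi>] by blast
  have "continuous_on (cball 0 R) (\<lambda>x. ln (\<Theta> \<beta> x))"
  proof (intro continuous_on_ln)
    show "continuous_on (cball 0 R) (\<Theta> \<beta>)"
      using v by (intro continuous_on_subset[OF smooth_continuous]) (auto simp: is_solution_def)
    show "\<forall>x\<in>cball 0 R. \<Theta> \<beta> x \<noteq> 0"
      using is_solution_pos[OF v] by (metis less_irrefl)
  qed
  then have "bounded ((\<lambda>x. ln (\<Theta> \<beta> x)) ` cball 0 R)"
    by (intro compact_imp_bounded compact_continuous_image compact_cball)
  then obtain C where C: "C > 0" "\<forall>x\<in>cball 0 R. \<bar>ln (\<Theta> \<beta> x)\<bar> \<le> C"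
    unfolding bounded_pos by auto
  have C': "\<bar>ln (\<Theta> \<beta> x)\<bar> \<le> C" if "\<Phi> x \<noteq> 0" for x using C(2) R[OF that] by auto
  define E where "E \<alpha> = exp (2 * (C * \<bar>\<alpha> - \<beta>\<bar>))" for \<alpha>
  let ?m = "\<lambda>\<alpha>. effective_mass \<Phi> \<alpha> (\<Theta> \<alpha>)"
  have Elim: "(E \<longlongrightarrow> 1) (at \<beta> within {0..1})"
  proof -
    have "(E \<longlongrightarrow> exp (2 * (C * \<bar>\<beta> - \<beta>\<bar>))) (at \<beta> within {0..1})"
      unfolding E_def[abs_def] by (intro tendsto_intros)
    then show ?thesis by simp
  qed
  have bd: "?m \<alpha> \<le> E \<alpha> * ?m \<beta>" "?m \<beta> / E \<alpha> \<le> ?m \<alpha>" if "\<alpha> \<in> {0..1}" for \<alpha>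
    using effective_mass_close[OF \<Theta>[OF that] v G \<Phi> _ _ less_imp_le[OF C(1)] C'] that
    by (simp_all add: E_def pos_divide_le_eq mult.commute)
  have ev: "eventually (\<lambda>\<alpha>. \<alpha> \<in> {0..1}) (at \<beta> within {0..1})"
    by (auto simp: eventually_at_filter)
  show "(?m \<longlongrightarrow> ?m \<beta>) (at \<beta> within {0..1})"
  proof (rule tendsto_sandwich)
    show "eventually (\<lambda>\<alpha>. ?m \<beta> / E \<alpha> \<le> ?m \<alpha>) (at \<beta> within {0..1})"
      using ev by eventually_elim (rule bd)
    show "eventually (\<lambda>\<alpha>. ?m \<alpha> \<le> E \<alpha> * ?m \<beta>) (at \<beta> within {0..1})"
      using ev by eventually_elim (rule bd)
    show "((\<lambda>\<alpha>. ?m \<beta> / E \<alpha>) \<longlongrightarrow> ?m \<beta>) (at \<beta> within {0..1})"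
      using tendsto_divide[OF tendsto_const Elim] by simp
    show "((\<lambda>\<alpha>. E \<alpha> * ?m \<beta>) \<longlongrightarrow> ?m \<beta>) (at \<beta> within {0..1})"
      using tendsto_mult_right[OF Elim] by simp
  qed
qed

theorem theorem3p1:
  fixes G c m :: real and \<Phi> :: "real^3 \<Rightarrow> real"
    and r d :: "nat \<Rightarrow> real"
    and \<omega> \<theta> :: "real \<Rightarrow> nat \<Rightarrow> real^3 \<Rightarrow> real"
    and \<Theta> :: "real \<Rightarrow> real^3 \<Rightarrow> real"
    and m_eff :: "real \<Rightarrow> real"
  assumes "G > 0" and "c > 0"
    and "matter_density \<Phi>"
    and "m = (LINT x|lborel. \<Phi> x)" and "m > 0"
    and "\<And>n. r n > 0" and "r \<longlonglongrightarrow> 0"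
    and "\<And>n. d n = inverse (G / (2 * c\<^sup>2) * (m / r n))"
    and "\<And>\<alpha> n x. \<alpha> \<in> {0..1} \<Longrightarrow>
           \<omega> \<alpha> n x = d n powr (- \<alpha>) * pushforward_dilation (d n) \<Phi> x"
    and "\<And>\<alpha> n. \<alpha> \<in> {0..1} \<Longrightarrow> is_solution G c \<alpha> (\<omega> \<alpha> n) 1 (\<theta> \<alpha> n)"
    and "\<And>\<alpha>. \<alpha> \<in> {0..1} \<Longrightarrow> is_solution G c \<alpha> \<Phi> 0 (\<Theta> \<alpha>)"
    and "\<And>\<alpha>. \<alpha> \<in> {0..1} \<Longrightarrow> m_eff \<alpha> = effective_mass \<Phi> \<alpha> (\<Theta> \<alpha>)"
  shows "(\<forall>\<alpha>\<in>{0..1}. \<forall>K. compact K \<and> K \<subseteq> UNIV - {0} \<longrightarrow>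
            (\<forall>\<gamma>. uniform_limit K (\<lambda>n. multi_deriv \<gamma> (\<theta> \<alpha> n))
                   (multi_deriv \<gamma> (theta_Schw G c (m_eff \<alpha>))) sequentially))
         \<and> continuous_on {0..1} m_eff"
proof (intro conjI ballI allI impI)
  \<comment> \<open>\<open>d n\<close> is a constant multiple of \<open>r n\<close>, which transfers
    both positivity and the limit 0.\<close>
  have d: "d n = r n * inverse (G / (2 * c\<^sup>2) * m)" for n
    unfolding assms(8) by simp
  have d0: "0 < d n" for n
    unfolding d using assms(1,2,5) assms(6)[of n] by simp
  have dlim: "d \<longlonglongrightarrow> 0"
    unfolding d[abs_def] by (rule tendsto_mult_left_zero[OF assms(7)])
  fix \<alpha> :: real and K :: "(real^3) set" and \<gamma>
  assume \<alpha>: "\<alpha> \<in> {0..1}" and K: "compact K \<and> K \<subseteq> UNIV - {0}"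
  have \<omega>: "\<omega> \<alpha> n = (\<lambda>x. d n powr (- \<alpha>) * pushforward_dilation (d n) \<Phi> x)" for n
    using assms(9)[OF \<alpha>] by (intro ext)
  show "uniform_limit K (\<lambda>n. multi_deriv \<gamma> (\<theta> \<alpha> n))
      (multi_deriv \<gamma> (theta_Schw G c (m_eff \<alpha>))) sequentially"
    unfolding assms(12)[OF \<alpha>]
    by (rule dilated_solutions_converge[OF assms(1,3) d0 dlim _ assms(10)[OF \<alpha>, unfolded \<omega>] assms(11)[OF \<alpha>]])
      (use \<alpha> K in auto)
next
  show "continuous_on {0..1} m_eff"
    by (rule continuous_on_eq[OF effective_mass_continuous[OF assms(1,3,11)]]) (auto simp: assms(12))
qed

end
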